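(* Let $X=[0,1]$ and $Y=\{0,1\}$, and let $\mathcal{K}:X\to\mathcal{P}(Y)$ be the kernel that sends $x\in[0,1]$ to the probability measure on $Y$ with $\{0\}\mapsto x$ and $\{1\}\mapsto 1-x$. Its associated Feller-Markov operator is $$\mathcal{F}:\mathcal{C}(Y)\cong\mathbb{C}^2\to\mathcal{C}([0,1]),\qquad (r,s)\mapsto\big[x\mapsto rx+s(1-x)\big].$$ Then $\mathcal{K}$ is not implemented by any random continuous map from $X$ to $Y$ and $\mathcal{F}$ is not classically implemented, but $\mathcal{F}$ is implemented by a random quantum map with parameter-algebra $\mathbf{M}_2$, the algebra of $2\times2$ complex matrices.
   Context: Conventions: every C*-algebra is unital; a morphism is a unit-preserving $*$-homomorphism; $\check{\otimes}$ is the spatial (minimal) tensor product; $\mathcal{S}(C)$ is the state space of $C$; $\mathcal{C}(X)$ is the C*-algebra of continuous complex functions on the compact Hausdorff space $X$; $\mathcal{P}(Y)$ is the set of regular Borel probability measures on $Y$ with the weak*-topology. Here $\mathcal{C}(Y)\cong\mathbb{C}^2$ via $f\mapsto(f(0),f(1))$. A kernel from $X$ to $Y$ is a weak*-continuous map $\mathcal{K}:X\to\mathcal{P}(Y)$. Its associated Feller-Markov operator is the unit-preserving positive linear map $\mathcal{C}(Y)\to\mathcal{C}(X)$, $f\mapsto\big(x\mapsto\int_Y f\,\mathrm{d}(\mathcal{K}x)\big)$. A random continuous map from $X$ to $Y$ is a triple $(Z,\phi,\nu)$ with $Z$ a compact Hausdorff space, $\nu$ a probability Borel measure on $Z$, and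 $\phi:X\times Z\to Y$ jointly continuous. It implements $\mathcal{K}$ if $(\mathcal{K}x)(E)=\nu\{z\in Z:\phi(x,z)\in E\}$ for all $x\in X$ and Borel $E\subseteq Y$. A random quantum map (RQM) from a C*-algebra $B$ to a C*-algebra $A$ is a triple $(C,\phi,\nu)$ where $C$ is a C*-algebra (the parameter-algebra), $\phi:B\to A\check{\otimes}C$ is a morphism, and $\nu\in\mathcal{S}(C)$; it is classical if $C$ is commutative. A unit-preserving completely positive linear map $\mathcal{F}:B\to A$ is implemented by $(C,\phi,\nu)$ if $\mathcal{F}(b)=(\mathrm{id}_A\otimes\nu)\phi(b)$ for all $b\in B$ (slice map); it is classically implemented if it is implemented by some classical RQM. *)

theory Defs
  imports "HOL-Probability.Probability" "HOL-Library.Z2"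
begin

section \<open>Complex normed spaces and unital C*-algebras\<close>

class scaleC =
  fixes scaleC :: "complex \<Rightarrow> 'a \<Rightarrow> 'a" (infixr \<open>*\<^sub>C\<close> 75)

class complex_normed_vector = real_normed_vector + scaleC +
  assumes scaleC_add_right: "c *\<^sub>C (x + y) = c *\<^sub>C x + c *\<^sub>C y"
    and scaleC_add_left: "(c + d) *\<^sub>C x = c *\<^sub>C x + d *\<^sub>C x"
    and scaleC_scaleC: "c *\<^sub>C (d *\<^sub>C x) = (c * d) *\<^sub>C x"
    and scaleC_of_real: "complex_of_real r *\<^sub>C x = r *\<^sub>R x"
    and norm_scaleC: "norm (c *\<^sub>C x) = cmod c * norm x"

class star =
  fixes star :: "'a \<Rightarrow> 'a"

text \<open>
  Unital C*-algebras.  The superclass \<^class>\<open>real_normed_algebra_1\<close> excludes only the zero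
  algebra, which has no states.
\<close>

class cstar_algebra = complex_normed_vector + real_normed_algebra_1 + complete_space + star +
  assumes scaleC_mult_left: "(c *\<^sub>C x) * y = c *\<^sub>C (x * y)"
    and scaleC_mult_right: "x * (c *\<^sub>C y) = c *\<^sub>C (x * y)"
    and star_star: "star (star x) = x"
    and star_add: "star (x + y) = star x + star y"
    and star_scaleC: "star (c *\<^sub>C x) = cnj c *\<^sub>C star x"
    and star_mult: "star (x * y) = star y * star x"
    and cstar_identity: "norm (star x * x) = (norm x)\<^sup>2"

lemma bounded_linear_scaleC: "bounded_linear ((*\<^sub>C) c :: 'a \<Rightarrow> 'a::complex_normed_vector)"
proof (rule bounded_linear_intro[where K = "cmod c"])
  fix r :: real and x :: 'a
  show "c *\<^sub>C (r *\<^sub>R x) = r *\<^sub>R (c *\<^sub>C x)"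
    by (simp add: scaleC_scaleC mult.commute flip: scaleC_of_real)
qed (simp_all add: scaleC_add_right norm_scaleC mult.commute)

lemma norm_star: "norm (star x) = norm (x :: 'a::cstar_algebra)"
proof -
  have "norm x \<le> norm (star x)" for x :: 'a
  proof (cases "x = 0")
    case False
    have "norm x * norm x \<le> norm (star x) * norm x"
      using cstar_identity[of x] norm_mult_ineq[of "star x" x] by (simp add: power2_eq_square)
    then show ?thesis using False by simp
  qed simp
  from this[of x] this[of "star x"] show ?thesis by (simp add: star_star)
qed

lemma bounded_linear_star: "bounded_linear (star :: 'a \<Rightarrow> 'a::cstar_algebra)"
proof (rule bounded_linear_intro[where K = 1])
  fix r :: real and x :: 'a
  show "star (r *\<^sub>R x) = r *\<^sub>R star x"
    using star_scaleC[of "complex_of_real r" x] by (simp add: scaleC_of_real)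
qed (simp_all add: star_add norm_star)

instantiation complex :: cstar_algebra
begin
definition scaleC_complex :: "complex \<Rightarrow> complex \<Rightarrow> complex" where "scaleC_complex = (*)"
definition star_complex :: "complex \<Rightarrow> complex" where "star_complex = cnj"
instance
  by standard
     (auto simp: scaleC_complex_def star_complex_def algebra_simps norm_mult scaleR_conv_of_real
        power2_eq_square)
end

definition state :: "('c::cstar_algebra \<Rightarrow> complex) \<Rightarrow> bool" where
  "state \<nu> \<longleftrightarrow>
     (\<forall>x y. \<nu> (x + y) = \<nu> x + \<nu> y) \<and>
     (\<forall>c x. \<nu> (c *\<^sub>C x) = c * \<nu> x) \<and>
     (\<forall>x. \<nu> (star x * x) \<in> \<real>\<^sub>\<ge>\<^sub>0) \<and>
     \<nu> 1 = 1"

section \<open>The algebra of continuous functions\<close>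

text \<open>
  For compact \<open>X\<close> every continuous function is bounded, so \<open>X \<Rightarrow>\<^sub>C complex\<close> is the
  algebra of all continuous complex functions on \<open>X\<close> with the supremum norm.
\<close>

setup_lifting type_definition_bcontfun

instantiation bcontfun :: (topological_space, real_normed_algebra_1) real_normed_algebra_1
begin

lift_definition times_bcontfun :: "('a \<Rightarrow>\<^sub>C 'b) \<Rightarrow> ('a \<Rightarrow>\<^sub>C 'b) \<Rightarrow> 'a \<Rightarrow>\<^sub>C 'b"
  is "\<lambda>f g x. f x * g x"
proof -
  fix f g :: "'a \<Rightarrow> 'b"
  assume f: "f \<in> bcontfun" and g: "g \<in> bcontfun"
  then obtain a b where a: "\<And>x. norm (f x) \<le> a" and b: "\<And>x. norm (g x) \<le> b"
    unfolding bcontfun_def bounded_iff by auto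
  have "norm (f x * g x) \<le> a * b" for x
    by (rule order_trans[OF norm_mult_ineq])
       (meson a b mult_mono norm_ge_zero order_trans)
  moreover have "continuous_on UNIV (\<lambda>x. f x * g x)"
    using f g by (auto simp: bcontfun_def intro!: continuous_intros)
  ultimately show "(\<lambda>x. f x * g x) \<in> bcontfun"
    by (intro bcontfun_normI)
qed

lift_definition one_bcontfun :: "'a \<Rightarrow>\<^sub>C 'b" is "\<lambda>_. 1"
  by (rule const_bcontfun)

lemma times_bcontfun_apply [simp]: "apply_bcontfun (f * g) x = apply_bcontfun f x * apply_bcontfun g x"
  by transfer simp

lemma one_bcontfun_apply [simp]: "apply_bcontfun 1 x = 1"
  by transfer simp

instance
proof
  fix f g h :: "'a \<Rightarrow>\<^sub>C 'b" and r :: real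
  show "f * g * h = f * (g * h)" "1 * f = f" "f * 1 = f"
    "(f + g) * h = f * h + g * h" "f * (g + h) = f * g + f * h"
    "r *\<^sub>R f * g = r *\<^sub>R (f * g)" "f * r *\<^sub>R g = r *\<^sub>R (f * g)"
    by (auto intro!: bcontfun_eqI simp: algebra_simps)
  show "(0 :: 'a \<Rightarrow>\<^sub>C 'b) \<noteq> 1"
    by (metis one_bcontfun_apply zero_bcontfun.rep_eq zero_neq_one)
  show "norm (f * g) \<le> norm f * norm g"
  proof (rule norm_bound)
    fix x
    show "norm (apply_bcontfun (f * g) x) \<le> norm f * norm g"
      by (simp, rule order_trans[OF norm_mult_ineq])
         (intro mult_mono norm_bounded norm_ge_zero)
  qed
  have "norm (1 :: 'a \<Rightarrow>\<^sub>C 'b) \<le> 1" by (rule norm_bound) simp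
  moreover have "1 \<le> norm (1 :: 'a \<Rightarrow>\<^sub>C 'b)"
    using norm_bounded[of "1 :: 'a \<Rightarrow>\<^sub>C 'b" undefined] by simp
  ultimately show "norm (1 :: 'a \<Rightarrow>\<^sub>C 'b) = 1" by simp
qed

end

instantiation bcontfun :: (topological_space, complex_normed_vector) complex_normed_vector
begin

lift_definition scaleC_bcontfun :: "complex \<Rightarrow> ('a \<Rightarrow>\<^sub>C 'b) \<Rightarrow> 'a \<Rightarrow>\<^sub>C 'b"
  is "\<lambda>c f x. c *\<^sub>C f x"
proof -
  fix c :: complex and f :: "'a \<Rightarrow> 'b"
  assume f: "f \<in> bcontfun"
  then obtain a where a: "\<And>x. norm (f x) \<le> a"
    unfolding bcontfun_def bounded_iff by auto
  have "norm (c *\<^sub>C f x) \<le> cmod c * a" for x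
    by (simp add: norm_scaleC a mult_left_mono)
  moreover have "continuous_on UNIV (\<lambda>x. c *\<^sub>C f x)"
    using f bounded_linear.continuous_on[OF bounded_linear_scaleC]
    by (auto simp: bcontfun_def)
  ultimately show "(\<lambda>x. c *\<^sub>C f x) \<in> bcontfun"
    by (intro bcontfun_normI)
qed

lemma scaleC_bcontfun_apply [simp]: "apply_bcontfun (c *\<^sub>C f) x = c *\<^sub>C apply_bcontfun f x"
  by transfer simp

instance
proof
  fix f g :: "'a \<Rightarrow>\<^sub>C 'b" and c d :: complex and r :: real
  show "c *\<^sub>C (f + g) = c *\<^sub>C f + c *\<^sub>C g" "(c + d) *\<^sub>C f = c *\<^sub>C f + d *\<^sub>C f"
    "c *\<^sub>C (d *\<^sub>C f) = (c * d) *\<^sub>C f" "complex_of_real r *\<^sub>C f = r *\<^sub>R f"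
    by (auto intro!: bcontfun_eqI
        simp: scaleC_add_right scaleC_add_left scaleC_scaleC scaleC_of_real)
  have le: "norm (c *\<^sub>C f) \<le> cmod c * norm f" for c and f :: "'a \<Rightarrow>\<^sub>C 'b"
    by (rule norm_bound) (simp add: norm_scaleC mult_left_mono norm_bounded)
  show "norm (c *\<^sub>C f) = cmod c * norm f"
  proof (cases "c = 0")
    case True
    then show ?thesis using le[of c f] by simp
  next
    case False
    have "inverse c *\<^sub>C (c *\<^sub>C f) = f"
      using False
      by (auto intro!: bcontfun_eqI simp: scaleC_scaleC scaleC_of_real[of 1, simplified])
    then have "norm f \<le> cmod (inverse c) * norm (c *\<^sub>C f)"
      using le[of "inverse c" "c *\<^sub>C f"] by simp
    then have "cmod c * norm f \<le> norm (c *\<^sub>C f)"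
      using False by (simp add: norm_divide field_simps)
    then show ?thesis using le[of c f] by simp
  qed
qed

end

instantiation bcontfun :: (metric_space, cstar_algebra) cstar_algebra
begin

lift_definition star_bcontfun :: "('a \<Rightarrow>\<^sub>C 'b) \<Rightarrow> 'a \<Rightarrow>\<^sub>C 'b"
  is "\<lambda>f x. star (f x)"
proof -
  fix f :: "'a \<Rightarrow> 'b"
  assume f: "f \<in> bcontfun"
  then have "continuous_on UNIV (\<lambda>x. star (f x))"
    using bounded_linear.continuous_on[OF bounded_linear_star]
    by (auto simp: bcontfun_def)
  with f show "(\<lambda>x. star (f x)) \<in> bcontfun"
    by (auto simp: bcontfun_def bounded_iff norm_star)
qed

lemma star_bcontfun_apply [simp]: "apply_bcontfun (star f) x = star (apply_bcontfun f x)"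
  by transfer simp

instance
proof
  fix f g :: "'a \<Rightarrow>\<^sub>C 'b" and c :: complex
  show "(c *\<^sub>C f) * g = c *\<^sub>C (f * g)" "f * (c *\<^sub>C g) = c *\<^sub>C (f * g)" "star (star f) = f"
    "star (f + g) = star f + star g" "star (c *\<^sub>C f) = cnj c *\<^sub>C star f"
    "star (f * g) = star g * star f"
    by (auto intro!: bcontfun_eqI
        simp: scaleC_mult_left scaleC_mult_right star_star star_add star_scaleC star_mult)
  have star_le: "norm (star f) \<le> norm f"
    by (rule norm_bound) (simp add: norm_star norm_bounded)
  have "(norm (apply_bcontfun f x))\<^sup>2 \<le> norm (star f * f)" for x
    using norm_bounded[of "star f * f" x] by (simp add: cstar_identity)
  then have "norm (apply_bcontfun f x) \<le> sqrt (norm (star f * f))" for x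
    by (simp add: real_le_rsqrt)
  then have "norm f \<le> sqrt (norm (star f * f))"
    by (rule norm_bound)
  then have "(norm f)\<^sup>2 \<le> norm (star f * f)"
    by (metis norm_ge_zero real_sqrt_le_iff real_sqrt_unique)
  moreover have "norm (star f * f) \<le> (norm f)\<^sup>2"
    by (metis norm_mult_ineq star_le mult_right_mono norm_ge_zero order_trans power2_eq_square)
  ultimately show "norm (star f * f) = (norm f)\<^sup>2" by simp
qed

end

section \<open>The spaces \<open>[0,1]\<close> and \<open>{0,1}\<close>\<close>

typedef unit_interval = "{0..1::real}"
  morphisms real_of_unit unit_of_real
  by force

instantiation unit_interval :: metric_space
begin

definition dist_unit_interval :: "unit_interval \<Rightarrow> unit_interval \<Rightarrow> real"
  where "dist_unit_interval x y = dist (real_of_unit x) (real_of_unit y)"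

definition uniformity_unit_interval :: "(unit_interval \<times> unit_interval) filter"
  where "uniformity_unit_interval = (INF e\<in>{0 <..}. principal {(x, y). dist x y < e})"

definition open_unit_interval :: "unit_interval set \<Rightarrow> bool"
  where "open_unit_interval U = (\<forall>x\<in>U. \<forall>\<^sub>F (x', y) in uniformity. x' = x \<longrightarrow> y \<in> U)"

instance
proof
  fix x y z :: unit_interval
  show "dist x y = 0 \<longleftrightarrow> x = y"
    by (simp add: dist_unit_interval_def real_of_unit_inject)
  show "dist x y \<le> dist x z + dist y z"
    unfolding dist_unit_interval_def by (rule dist_triangle2)
qed (rule open_unit_interval_def uniformity_unit_interval_def)+

end

lemma compact_unit_interval: "compact (UNIV :: unit_interval set)"
proof -
  have "continuous_on {0..1} unit_of_real"
    unfolding continuous_on_iff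
    by (auto simp: dist_unit_interval_def unit_of_real_inverse)
  then have "compact (unit_of_real ` {0..1})"
    by (rule compact_continuous_image) simp
  then show ?thesis
    using type_definition.Abs_image[OF type_definition_unit_interval] by simp
qed

instantiation bit :: metric_space
begin

definition dist_bit :: "bit \<Rightarrow> bit \<Rightarrow> real"
  where "dist_bit x y = (if x = y then 0 else 1)"

definition uniformity_bit :: "(bit \<times> bit) filter"
  where "uniformity_bit = (INF e\<in>{0 <..}. principal {(x, y). dist x y < e})"

definition open_bit :: "bit set \<Rightarrow> bool"
  where "open_bit U = (\<forall>x\<in>U. \<forall>\<^sub>F (x', y) in uniformity. x' = x \<longrightarrow> y \<in> U)"

instance
  by standard (auto simp: dist_bit_def open_bit_def uniformity_bit_def)

end

instance bit :: discrete_topology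
proof
  fix U :: "bit set"
  have "\<exists>e>0. \<forall>y. dist y x < e \<longrightarrow> y \<in> U" if "x \<in> U" for x
    using that by (intro exI[of _ 1]) (auto simp: dist_bit_def split: if_splits)
  then show "open U" by (simp add: open_dist)
qed

section \<open>The matrix algebras\<close>

typedef 'n cmatrix = "UNIV :: (complex^'n^'n) set"
  morphisms mat_of cmatrix_of ..

setup_lifting type_definition_cmatrix

instantiation cmatrix :: (finite) real_vector
begin
lift_definition zero_cmatrix :: "'a cmatrix" is 0 .
lift_definition plus_cmatrix :: "'a cmatrix \<Rightarrow> 'a cmatrix \<Rightarrow> 'a cmatrix" is "(+)" .
lift_definition minus_cmatrix :: "'a cmatrix \<Rightarrow> 'a cmatrix \<Rightarrow> 'a cmatrix" is "(-)" .
lift_definition uminus_cmatrix :: "'a cmatrix \<Rightarrow> 'a cmatrix" is "uminus" .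
lift_definition scaleR_cmatrix :: "real \<Rightarrow> 'a cmatrix \<Rightarrow> 'a cmatrix" is "scaleR" .
instance by standard (transfer; simp add: algebra_simps)+
end

lemma bounded_linear_matrix_vector [simp]: "bounded_linear ((*v) (A :: complex^'n^'n))"
  by (rule matrix_vector_mul_bounded_linear)

lemma cmatrix_vector_add: "(A + B) *v x = A *v x + B *v x" for A :: "complex^'n^'n"
  by (rule matrix_vector_mult_add_rdistrib)

lemma cmatrix_vector_scaleR: "(r *\<^sub>R A) *v x = r *\<^sub>R (A *v x)" for A :: "complex^'n^'n"
  by (simp add: vec_eq_iff matrix_vector_mult_def scaleR_sum_right)

text \<open>
  The C*-norm is the operator norm on complex n-space with its Euclidean (Hermitian) norm.
\<close>

instantiation cmatrix :: (finite) real_normed_vector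
begin
definition norm_cmatrix :: "'a cmatrix \<Rightarrow> real"
  where "norm_cmatrix A = onorm ((*v) (mat_of A))"
definition dist_cmatrix :: "'a cmatrix \<Rightarrow> 'a cmatrix \<Rightarrow> real"
  where "dist_cmatrix A B = norm (A - B)"
definition sgn_cmatrix :: "'a cmatrix \<Rightarrow> 'a cmatrix"
  where "sgn_cmatrix A = A /\<^sub>R norm A"
definition uniformity_cmatrix :: "('a cmatrix \<times> 'a cmatrix) filter"
  where "uniformity_cmatrix = (INF e\<in>{0 <..}. principal {(x, y). dist x y < e})"
definition open_cmatrix :: "'a cmatrix set \<Rightarrow> bool"
  where "open_cmatrix U = (\<forall>x\<in>U. \<forall>\<^sub>F (x', y) in uniformity. x' = x \<longrightarrow> y \<in> U)"
instance
proof
  fix A B :: "'a cmatrix" and r :: real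
  show "norm A = 0 \<longleftrightarrow> A = 0"
    by (simp add: norm_cmatrix_def onorm_eq_0 fun_eq_iff flip: mat_of_inject)
       (metis matrix_eq matrix_vector_mult_0 zero_cmatrix.rep_eq)
  show "norm (A + B) \<le> norm A + norm B"
    using onorm_triangle[of "(*v) (mat_of A)" "(*v) (mat_of B)"]
    by (simp add: norm_cmatrix_def plus_cmatrix.rep_eq cmatrix_vector_add[abs_def])
  show "norm (r *\<^sub>R A) = \<bar>r\<bar> * norm A"
    using onorm_scaleR[of "(*v) (mat_of A)" r]
    by (simp add: norm_cmatrix_def scaleR_cmatrix.rep_eq cmatrix_vector_scaleR[abs_def])
qed (simp_all add: dist_cmatrix_def sgn_cmatrix_def open_cmatrix_def uniformity_cmatrix_def)
end


lemma norm_cmatrix_entry: "cmod (mat_of A $ i $ j) \<le> norm A"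
proof -
  have "cmod (mat_of A $ i $ j) = cmod ((mat_of A *v axis j 1) $ i)"
    by (simp add: matrix_vector_mult_def axis_def mult_delta_right)
  also have "\<dots> \<le> norm (mat_of A *v axis j 1)"
    by (rule Finite_Cartesian_Product.norm_nth_le)
  also have "\<dots> \<le> onorm ((*v) (mat_of A)) * norm (axis j (1::complex))"
    by (rule onorm) simp
  finally show ?thesis
    by (simp add: norm_cmatrix_def norm_eq_sqrt_inner[of "axis j 1"] inner_axis_axis)
qed

lemma bounded_linear_mat_of: "bounded_linear (mat_of :: 'n::finite cmatrix \<Rightarrow> _)"
proof (rule bounded_linear_intro)
  fix A B :: "'n cmatrix" and r :: real
  show "mat_of (A + B) = mat_of A + mat_of B" by (rule plus_cmatrix.rep_eq)
  show "mat_of (r *\<^sub>R A) = r *\<^sub>R mat_of A" by (rule scaleR_cmatrix.rep_eq)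
  have row: "norm (mat_of A $ i) \<le> real CARD('n) * norm A" for i
  proof -
    have "norm (mat_of A $ i) \<le> (\<Sum>j\<in>UNIV. cmod (mat_of A $ i $ j))"
      unfolding norm_vec_def by (rule L2_set_le_sum) simp
    also have "\<dots> \<le> real CARD('n) * norm A"
      by (rule sum_bounded_above) (rule norm_cmatrix_entry)
    finally show ?thesis .
  qed
  have "norm (mat_of A) \<le> (\<Sum>i\<in>UNIV. norm (mat_of A $ i))"
    unfolding norm_vec_def by (rule L2_set_le_sum) simp
  also have "\<dots> \<le> real CARD('n) * (real CARD('n) * norm A)"
    by (rule sum_bounded_above) (rule row)
  finally show "norm (mat_of A) \<le> norm A * (real CARD('n) * real CARD('n))"
    by (simp add: mult_ac)
qed

lemma bounded_linear_cmatrix_of: "bounded_linear (cmatrix_of :: _ \<Rightarrow> 'n::finite cmatrix)"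
  by (subst linear_conv_bounded_linear[symmetric])
     (auto intro!: linearI simp: plus_cmatrix.abs_eq scaleR_cmatrix.abs_eq)

instance cmatrix :: (finite) complete_space
proof
  fix X :: "nat \<Rightarrow> 'a cmatrix"
  assume "Cauchy X"
  then have "Cauchy (\<lambda>n. mat_of (X n))"
    by (rule bounded_linear.Cauchy[OF bounded_linear_mat_of])
  then obtain A where "(\<lambda>n. mat_of (X n)) \<longlonglongrightarrow> A"
    using Cauchy_convergent convergent_def by blast
  from bounded_linear.tendsto[OF bounded_linear_cmatrix_of this]
  have "X \<longlonglongrightarrow> cmatrix_of A"
    by (simp add: mat_of_inverse)
  then show "convergent X"
    by (rule convergentI)
qed

instantiation cmatrix :: (finite) real_normed_algebra_1
begin
lift_definition times_cmatrix :: "'a cmatrix \<Rightarrow> 'a cmatrix \<Rightarrow> 'a cmatrix" is "(**)" .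
lift_definition one_cmatrix :: "'a cmatrix" is "mat 1" .
instance
proof
  fix A B C :: "'a cmatrix" and r :: real
  show "A * B * C = A * (B * C)" by transfer (simp add: matrix_mul_assoc)
  show "1 * A = A" "A * 1 = A" by (transfer, simp)+
  show "(A + B) * C = A * C + B * C" "A * (B + C) = A * B + A * C"
    by (transfer, simp add: vec_eq_iff matrix_matrix_mult_def distrib_left distrib_right sum.distrib)+
  show "r *\<^sub>R A * B = r *\<^sub>R (A * B)" "A * r *\<^sub>R B = r *\<^sub>R (A * B)"
    by (transfer, simp add: vec_eq_iff matrix_matrix_mult_def scaleR_sum_right)+
  show "(0 :: 'a cmatrix) \<noteq> 1"
    by transfer (auto simp: vec_eq_iff mat_def)
  show "norm (A * B) \<le> norm A * norm B"
    using onorm_compose[of "(*v) (mat_of A)" "(*v) (mat_of B)"]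
    by (simp add: norm_cmatrix_def times_cmatrix.rep_eq o_def matrix_vector_mul_assoc)
  show "norm (1 :: 'a cmatrix) = 1"
    using onorm_id[where 'a = "complex^'a"]
    by (simp add: norm_cmatrix_def one_cmatrix.rep_eq[abs_def] id_def[abs_def] matrix_vector_mul_lid[abs_def])
qed
end

instantiation cmatrix :: (finite) cstar_algebra
begin
lift_definition scaleC_cmatrix :: "complex \<Rightarrow> 'a cmatrix \<Rightarrow> 'a cmatrix"
  is "\<lambda>c A. \<chi> i j. c * A $ i $ j" .
lift_definition star_cmatrix :: "'a cmatrix \<Rightarrow> 'a cmatrix"
  is "\<lambda>A. \<chi> i j. cnj (A $ j $ i)" .

lemma scaleC_cmatrix_mult_vec: "mat_of (c *\<^sub>C A) *v x = c *s (mat_of A *v x)"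
  by (simp add: scaleC_cmatrix.rep_eq vec_eq_iff matrix_vector_mult_def sum_distrib_left mult.assoc)

lemma norm_complex_smult: "norm (c *s (x :: complex^'a)) = cmod c * norm x"
  by (simp add: norm_vec_def norm_mult L2_set_right_distrib)

lemma star_cmatrix_adjoint:
  "inner (mat_of A *v x) y = inner x (mat_of (star A) *v y)"
proof -
  have "inner (mat_of A *v x) y = (\<Sum>i\<in>UNIV. \<Sum>j\<in>UNIV. inner (mat_of A $ i $ j * x $ j) (y $ i))"
    by (simp add: inner_vec_def matrix_vector_mult_def inner_sum_left)
  also have "\<dots> = (\<Sum>j\<in>UNIV. \<Sum>i\<in>UNIV. inner (mat_of A $ i $ j * x $ j) (y $ i))"
    by (rule sum.swap)
  also have "\<dots> = (\<Sum>j\<in>UNIV. \<Sum>i\<in>UNIV. inner (x $ j) (cnj (mat_of A $ i $ j) * y $ i))"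
    by (simp add: inner_complex_def algebra_simps)
  also have "\<dots> = inner x (mat_of (star A) *v y)"
    by (simp add: inner_vec_def matrix_vector_mult_def inner_sum_right star_cmatrix.rep_eq)
  finally show ?thesis .
qed

instance
proof
  fix A B :: "'a cmatrix" and c d :: complex and r :: real
  show "c *\<^sub>C (A + B) = c *\<^sub>C A + c *\<^sub>C B" "(c + d) *\<^sub>C A = c *\<^sub>C A + d *\<^sub>C A"
    "c *\<^sub>C (d *\<^sub>C A) = (c * d) *\<^sub>C A"
    by (transfer, simp add: vec_eq_iff algebra_simps)+
  show "complex_of_real r *\<^sub>C A = r *\<^sub>R A"
    by (transfer, simp only: vec_eq_iff vec_lambda_beta vector_scaleR_component)
       (simp add: scaleR_conv_of_real)
  show "norm (c *\<^sub>C A) = cmod c * norm A"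
  proof -
    have "bounded_linear (\<lambda>x. mat_of (c *\<^sub>C A) *v x)" by simp
    then have le: "norm (c *\<^sub>C A) \<le> cmod c * norm A" for c and A :: "'a cmatrix"
      unfolding norm_cmatrix_def scaleC_cmatrix_mult_vec[abs_def]
      by (intro onorm_bound)
         (auto simp: norm_complex_smult mult.assoc onorm_pos_le intro!: mult_left_mono onorm)
    show ?thesis
    proof (cases "c = 0")
      case True
      then show ?thesis using le[of c A] by simp
    next
      case False
      have "inverse c *\<^sub>C (c *\<^sub>C A) = A"
        using False by transfer (simp add: vec_eq_iff)
      then have "norm A \<le> cmod (inverse c) * norm (c *\<^sub>C A)"
        using le[of "inverse c" "c *\<^sub>C A"] by simp
      then have "cmod c * norm A \<le> norm (c *\<^sub>C A)"
        using False by (simp add: norm_divide field_simps)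
      then show ?thesis using le[of c A] by simp
    qed
  qed
  show "(c *\<^sub>C A) * B = c *\<^sub>C (A * B)" "A * (c *\<^sub>C B) = c *\<^sub>C (A * B)"
    by (transfer, simp add: vec_eq_iff matrix_matrix_mult_def sum_distrib_left algebra_simps)+
  show "star (star A) = A" "star (A + B) = star A + star B" "star (c *\<^sub>C A) = cnj c *\<^sub>C star A"
    by (transfer, simp add: vec_eq_iff)+
  show "star (A * B) = star B * star A"
    by (transfer, simp add: vec_eq_iff matrix_matrix_mult_def mult.commute)
  have sq: "(norm (mat_of A *v x))\<^sup>2 \<le> norm (star A * A) * (norm x)\<^sup>2" for A :: "'a cmatrix" and x
  proof -
    have "(norm (mat_of A *v x))\<^sup>2 = inner x (mat_of (star A * A) *v x)"
      by (simp add: power2_norm_eq_inner star_cmatrix_adjoint times_cmatrix.rep_eq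
          matrix_vector_mul_assoc)
    also have "\<dots> \<le> norm x * norm (mat_of (star A * A) *v x)"
      by (rule norm_cauchy_schwarz)
    also have "\<dots> \<le> norm x * (norm (star A * A) * norm x)"
      unfolding norm_cmatrix_def by (intro mult_left_mono onorm) simp_all
    finally show ?thesis by (simp add: power2_eq_square mult_ac)
  qed
  have le: "(norm A)\<^sup>2 \<le> norm (star A * A)" for A :: "'a cmatrix"
  proof -
    have "norm (mat_of A *v x) \<le> sqrt (norm (star A * A)) * norm x" for x
      using real_le_rsqrt[OF sq[of A x]] by (simp add: real_sqrt_mult)
    then have "norm A \<le> sqrt (norm (star A * A))"
      unfolding norm_cmatrix_def by (intro onorm_bound) (simp_all flip: norm_cmatrix_def)
    then show ?thesis
      by (metis norm_ge_zero real_sqrt_le_iff real_sqrt_unique)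
  qed
  have star_star: "star (star A) = A" for A :: "'a cmatrix"
    by (transfer, simp add: vec_eq_iff)
  have "norm A \<le> norm (star A)" for A :: "'a cmatrix"
  proof (cases "A = 0")
    case False
    have "norm A * norm A \<le> norm (star A) * norm A"
      using le[of A] norm_mult_ineq[of "star A" A] by (simp add: power2_eq_square)
    then show ?thesis using False by simp
  qed simp
  from this[of "star A"] have "norm (star A) \<le> norm A" by (simp add: star_star)
  then have "norm (star A * A) \<le> (norm A)\<^sup>2"
    by (metis norm_mult_ineq mult_right_mono norm_ge_zero order_trans power2_eq_square)
  with le[of A] show "norm (star A * A) = (norm A)\<^sup>2" by simp
qed
end

section \<open>Hilbert spaces of square-summable families\<close>

text \<open>
  Every complex Hilbert space is isometrically isomorphic to one of these, the index set being
  an orthonormal basis.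
\<close>

typedef 'i ell2 = "{f :: 'i \<Rightarrow> complex. (\<lambda>i. (cmod (f i))\<^sup>2) summable_on UNIV}"
  morphisms ell2_nth Abs_ell2
  by (rule exI[of _ "\<lambda>_. 0"]) simp

setup_lifting type_definition_ell2

lemma ell2_prod_summable:
  assumes "(\<lambda>i. (cmod (f i))\<^sup>2) summable_on A" "(\<lambda>i. (cmod (g i))\<^sup>2) summable_on A"
  shows "(\<lambda>i. cnj (f i) * g i) summable_on A"
proof (rule abs_summable_summable, rule Infinite_Sum.abs_summable_on_comparison_test)
  show "(\<lambda>i. norm ((cmod (f i))\<^sup>2 + (cmod (g i))\<^sup>2)) summable_on A"
    using summable_on_add[OF assms] by simp
  show "norm (cnj (f i) * g i) \<le> norm ((cmod (f i))\<^sup>2 + (cmod (g i))\<^sup>2)" for i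
  proof -
    have "2 * (cmod (f i) * cmod (g i)) \<le> (cmod (f i))\<^sup>2 + (cmod (g i))\<^sup>2"
      using sum_squares_bound[of "cmod (f i)" "cmod (g i)"] by (simp only: mult.assoc)
    moreover have "0 \<le> cmod (f i) * cmod (g i)" by simp
    moreover have "norm (cnj (f i) * g i) = cmod (f i) * cmod (g i)" by (simp add: norm_mult)
    ultimately show ?thesis unfolding real_norm_def by linarith
  qed
qed

instantiation ell2 :: (type) real_vector
begin
lift_definition zero_ell2 :: "'a ell2" is "\<lambda>_. 0" by simp
lift_definition scaleR_ell2 :: "real \<Rightarrow> 'a ell2 \<Rightarrow> 'a ell2" is "\<lambda>r f i. r *\<^sub>R f i"
  by (simp add: power_mult_distrib summable_on_cmult_right)
lift_definition plus_ell2 :: "'a ell2 \<Rightarrow> 'a ell2 \<Rightarrow> 'a ell2" is "\<lambda>f g i. f i + g i"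
proof -
  fix f g :: "'a \<Rightarrow> complex"
  assume f: "(\<lambda>i. (cmod (f i))\<^sup>2) summable_on UNIV" and g: "(\<lambda>i. (cmod (g i))\<^sup>2) summable_on UNIV"
  have sum: "(\<lambda>i. 2 * ((cmod (f i))\<^sup>2 + (cmod (g i))\<^sup>2)) summable_on UNIV"
    by (intro summable_on_cmult_right summable_on_add f g)
  have le: "(cmod (f i + g i))\<^sup>2 \<le> 2 * ((cmod (f i))\<^sup>2 + (cmod (g i))\<^sup>2)" for i
  proof -
    have "(cmod (f i + g i))\<^sup>2 \<le> (cmod (f i) + cmod (g i))\<^sup>2"
      by (intro power_mono norm_triangle_ineq) simp
    also have "\<dots> \<le> 2 * ((cmod (f i))\<^sup>2 + (cmod (g i))\<^sup>2)"
      using sum_squares_bound[of "cmod (f i)" "cmod (g i)"] by (simp add: power2_sum)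
    finally show ?thesis .
  qed
  show "(\<lambda>i. (cmod (f i + g i))\<^sup>2) summable_on UNIV"
    by (rule summable_on_comparison_test[OF sum]) (rule le, rule zero_le_power2)
qed
lift_definition uminus_ell2 :: "'a ell2 \<Rightarrow> 'a ell2" is "\<lambda>f i. - f i" by simp
definition minus_ell2 :: "'a ell2 \<Rightarrow> 'a ell2 \<Rightarrow> 'a ell2" where "minus_ell2 x y = x + - y"
instance
proof
  fix x y z :: "'a ell2" and r s :: real
  show "x + y + z = x + (y + z)" "x + y = y + x" "0 + x = x" "- x + x = 0"
    by (transfer, simp add: fun_eq_iff)+
  show "x - y = x + - y" by (rule minus_ell2_def)
  show "r *\<^sub>R (x + y) = r *\<^sub>R x + r *\<^sub>R y" "(r + s) *\<^sub>R x = r *\<^sub>R x + s *\<^sub>R x"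
    by (transfer, simp add: fun_eq_iff scaleR_add_right scaleR_add_left)+
  show "r *\<^sub>R s *\<^sub>R x = (r * s) *\<^sub>R x" "1 *\<^sub>R x = x"
    by (transfer, simp)+
qed
end

lift_definition cinner :: "'i ell2 \<Rightarrow> 'i ell2 \<Rightarrow> complex"
  is "\<lambda>f g. \<Sum>\<^sub>\<infinity>i. cnj (f i) * g i" .

lemma ell2_summable: "(\<lambda>i. (cmod (ell2_nth x i))\<^sup>2) summable_on UNIV"
  using ell2_nth[of x] by simp

lemma cinner_summable: "(\<lambda>i. cnj (ell2_nth x i) * ell2_nth y i) summable_on UNIV"
  by (intro ell2_prod_summable ell2_summable)

lemma cinner_add_left: "cinner (x + y) z = cinner x z + cinner y z"
  unfolding cinner.rep_eq plus_ell2.rep_eq complex_cnj_add distrib_right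
  by (intro infsum_add cinner_summable)

lemma cinner_commute: "cinner x y = cnj (cinner y x)"
  unfolding cinner.rep_eq infsum_cnj[symmetric] by (simp add: mult.commute)

lemma cinner_scaleR_left: "cinner (r *\<^sub>R x) y = r *\<^sub>R cinner x y"
  unfolding cinner.rep_eq scaleR_ell2.rep_eq
  by (simp add: scaleR_conv_of_real mult.assoc infsum_cmult_right')

lemma cinner_self: "cinner x x = of_real (\<Sum>\<^sub>\<infinity>i. (cmod (ell2_nth x i))\<^sup>2)"
proof -
  have "cnj z * z = complex_of_real ((cmod z)\<^sup>2)" for z
    by (metis complex_norm_square mult.commute)
  then have "cinner x x = (\<Sum>\<^sub>\<infinity>i. complex_of_real ((cmod (ell2_nth x i))\<^sup>2))"
    unfolding cinner.rep_eq by (simp only:)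
  also have "\<dots> = of_real (\<Sum>\<^sub>\<infinity>i. (cmod (ell2_nth x i))\<^sup>2)"
    by (intro infsumI has_sum_of_real has_sum_infsum ell2_summable)
  finally show ?thesis .
qed

instantiation ell2 :: (type) real_inner
begin
definition inner_ell2 :: "'a ell2 \<Rightarrow> 'a ell2 \<Rightarrow> real" where "inner_ell2 x y = Re (cinner x y)"
definition norm_ell2 :: "'a ell2 \<Rightarrow> real" where "norm_ell2 x = sqrt (inner x x)"
definition dist_ell2 :: "'a ell2 \<Rightarrow> 'a ell2 \<Rightarrow> real" where "dist_ell2 x y = norm (x - y)"
definition sgn_ell2 :: "'a ell2 \<Rightarrow> 'a ell2" where "sgn_ell2 x = x /\<^sub>R norm x"
definition uniformity_ell2 :: "('a ell2 \<times> 'a ell2) filter"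
  where "uniformity_ell2 = (INF e\<in>{0 <..}. principal {(x, y). dist x y < e})"
definition open_ell2 :: "'a ell2 set \<Rightarrow> bool"
  where "open_ell2 U = (\<forall>x\<in>U. \<forall>\<^sub>F (x', y) in uniformity. x' = x \<longrightarrow> y \<in> U)"
instance
proof
  fix x y z :: "'a ell2" and r :: real
  show "inner x y = inner y x"
    by (subst (2) inner_ell2_def, subst cinner_commute) (simp add: inner_ell2_def)
  show "inner (x + y) z = inner x z + inner y z"
    by (simp add: inner_ell2_def cinner_add_left)
  show "inner (r *\<^sub>R x) y = r * inner x y"
    by (simp add: inner_ell2_def cinner_scaleR_left)
  show "0 \<le> inner x x"
    by (simp add: inner_ell2_def cinner_self infsum_nonneg)
  show "inner x x = 0 \<longleftrightarrow> x = 0"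
  proof
    assume "inner x x = 0"
    then have "(\<Sum>\<^sub>\<infinity>i. (cmod (ell2_nth x i))\<^sup>2) = 0"
      by (simp add: inner_ell2_def cinner_self)
    then have "ell2_nth x i = 0" for i
      using nonneg_infsum_le_0D[of "\<lambda>i. (cmod (ell2_nth x i))\<^sup>2" UNIV i] ell2_summable[of x] by simp
    then show "x = 0" by transfer (simp add: fun_eq_iff)
  qed (simp add: inner_ell2_def cinner_self zero_ell2.rep_eq)
qed (simp_all add: norm_ell2_def dist_ell2_def sgn_ell2_def open_ell2_def uniformity_ell2_def)
end

instantiation ell2 :: (type) complex_normed_vector
begin
lift_definition scaleC_ell2 :: "complex \<Rightarrow> 'a ell2 \<Rightarrow> 'a ell2" is "\<lambda>c f i. c * f i"
  by (simp add: norm_mult power_mult_distrib summable_on_cmult_right)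
instance
proof
  fix x y :: "'a ell2" and c d :: complex and r :: real
  show "c *\<^sub>C (x + y) = c *\<^sub>C x + c *\<^sub>C y" "(c + d) *\<^sub>C x = c *\<^sub>C x + d *\<^sub>C x"
    "c *\<^sub>C (d *\<^sub>C x) = (c * d) *\<^sub>C x" "complex_of_real r *\<^sub>C x = r *\<^sub>R x"
    by (transfer, simp add: fun_eq_iff distrib_left distrib_right mult.assoc scaleR_conv_of_real)+
  have "cinner (c *\<^sub>C x) (c *\<^sub>C x) = of_real ((cmod c)\<^sup>2) * cinner x x"
    unfolding cinner_self scaleC_ell2.rep_eq norm_mult power_mult_distrib infsum_cmult_right'
    by (rule of_real_mult)
  then have "inner (c *\<^sub>C x) (c *\<^sub>C x) = (cmod c)\<^sup>2 * inner x x"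
    unfolding inner_ell2_def by (simp only: Re_complex_of_real times_complex.sel Im_complex_of_real)
  then show "norm (c *\<^sub>C x) = cmod c * norm x"
    by (simp only: norm_ell2_def real_sqrt_mult real_sqrt_abs abs_norm_cancel)
qed
end

lift_definition ell2_tensor :: "'i ell2 \<Rightarrow> 'j ell2 \<Rightarrow> ('i \<times> 'j) ell2" (infixr \<open>\<otimes>\<^sub>2\<close> 70)
  is "\<lambda>f g (i, j). f i * g j"
proof -
  fix f :: "'i \<Rightarrow> complex" and g :: "'j \<Rightarrow> complex"
  assume f: "(\<lambda>i. (cmod (f i))\<^sup>2) summable_on UNIV" and g: "(\<lambda>i. (cmod (g i))\<^sup>2) summable_on UNIV"
  have "(\<lambda>p. norm ((cmod (f (fst p)))\<^sup>2 * (cmod (g (snd p)))\<^sup>2)) summable_on UNIV \<times> UNIV"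
    by (rule Infinite_Sum.abs_summable_on_Sigma_iff[THEN iffD2])
       (use f g in \<open>auto simp: summable_on_cmult_right infsum_cmult_right' summable_on_cmult_left infsum_nonneg\<close>)
  then show "(\<lambda>p. (cmod (case p of (i, j) \<Rightarrow> f i * g j))\<^sup>2) summable_on UNIV"
    by (simp add: case_prod_unfold norm_mult power_mult_distrib)
qed

section \<open>Bounded operators and representations\<close>

instantiation blinfun :: (real_normed_vector, complex_normed_vector) complex_normed_vector
begin
lift_definition scaleC_blinfun :: "complex \<Rightarrow> ('a \<Rightarrow>\<^sub>L 'b) \<Rightarrow> 'a \<Rightarrow>\<^sub>L 'b"
  is "\<lambda>c f x. c *\<^sub>C f x"
  by (rule bounded_linear_compose[OF bounded_linear_scaleC])
instance
proof
  fix S T :: "'a \<Rightarrow>\<^sub>L 'b" and c d :: complex and r :: real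
  show "c *\<^sub>C (S + T) = c *\<^sub>C S + c *\<^sub>C T" "(c + d) *\<^sub>C S = c *\<^sub>C S + d *\<^sub>C S"
    "c *\<^sub>C (d *\<^sub>C S) = (c * d) *\<^sub>C S" "complex_of_real r *\<^sub>C S = r *\<^sub>R S"
    by (auto intro!: blinfun_eqI simp: scaleC_blinfun.rep_eq blinfun.add_left blinfun.scaleR_left
        scaleC_add_right scaleC_add_left scaleC_scaleC scaleC_of_real)
  have le: "norm (c *\<^sub>C S) \<le> cmod c * norm S" for c and S :: "'a \<Rightarrow>\<^sub>L 'b"
    by (rule norm_blinfun_bound)
       (auto simp: scaleC_blinfun.rep_eq norm_scaleC mult.assoc intro!: mult_left_mono norm_blinfun)
  show "norm (c *\<^sub>C S) = cmod c * norm S"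
  proof (cases "c = 0")
    case True
    then show ?thesis using le[of c S] by simp
  next
    case False
    have "inverse c *\<^sub>C (c *\<^sub>C S) = S"
      using False
      by (auto intro!: blinfun_eqI
          simp: scaleC_blinfun.rep_eq scaleC_scaleC scaleC_of_real[of 1, simplified])
    then have "norm S \<le> cmod (inverse c) * norm (c *\<^sub>C S)"
      using le[of "inverse c" "c *\<^sub>C S"] by simp
    then have "cmod c * norm S \<le> norm (c *\<^sub>C S)"
      using False by (simp add: norm_divide field_simps)
    then show ?thesis using le[of c S] by simp
  qed
qed
end

text \<open>
  Elements of the following type are bounded real-linear maps; complex linearity is always
  required separately.
\<close>

type_synonym 'i op = "'i ell2 \<Rightarrow>\<^sub>L 'i ell2"

definition complex_linear :: "'i op \<Rightarrow> bool" where
  "complex_linear T \<longleftrightarrow> (\<forall>c \<xi>. blinfun_apply T (c *\<^sub>C \<xi>) = c *\<^sub>C blinfun_apply T \<xi>)"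

text \<open>Unital *-homomorphisms into the bounded operators on a Hilbert space.\<close>

definition representation :: "('a::cstar_algebra \<Rightarrow> 'i op) \<Rightarrow> bool" where
  "representation \<pi> \<longleftrightarrow>
     (\<forall>a. complex_linear (\<pi> a)) \<and>
     (\<forall>a b. \<pi> (a + b) = \<pi> a + \<pi> b) \<and>
     (\<forall>c a. \<pi> (c *\<^sub>C a) = c *\<^sub>C \<pi> a) \<and>
     (\<forall>a b. \<pi> (a * b) = \<pi> a o\<^sub>L \<pi> b) \<and>
     \<pi> 1 = id_blinfun \<and>
     (\<forall>a \<xi> \<eta>. cinner (blinfun_apply (\<pi> (star a)) \<xi>) \<eta> = cinner \<xi> (blinfun_apply (\<pi> a) \<eta>))"

definition faithful_representation :: "('a::cstar_algebra \<Rightarrow> 'i op) \<Rightarrow> bool" where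
  "faithful_representation \<pi> \<longleftrightarrow> representation \<pi> \<and> inj \<pi>"

section \<open>The spatial tensor product\<close>

definition op_tensor :: "'i op \<Rightarrow> 'j op \<Rightarrow> ('i \<times> 'j) op" where
  "op_tensor S T = (THE W. complex_linear W \<and>
     (\<forall>\<xi> \<eta>. blinfun_apply W (\<xi> \<otimes>\<^sub>2 \<eta>) = blinfun_apply S \<xi> \<otimes>\<^sub>2 blinfun_apply T \<eta>))"

text \<open>
  The spatial tensor product of \<open>A\<close> and \<open>C\<close>, realized through faithful representations \<open>\<pi>\<close> of
  \<open>A\<close> and \<open>\<rho>\<close> of \<open>C\<close>; up to isomorphism it does not depend on their choice.  The real span is
  also the complex span, since \<open>c *\<^sub>C op_tensor (\<pi> a) (\<rho> b) = op_tensor (\<pi> (c *\<^sub>C a)) (\<rho> b)\<close>.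
\<close>

definition spatial_tensor ::
    "('a::cstar_algebra \<Rightarrow> 'i op) \<Rightarrow> ('c::cstar_algebra \<Rightarrow> 'j op) \<Rightarrow> ('i \<times> 'j) op set" where
  "spatial_tensor \<pi> \<rho> = closure (span {op_tensor (\<pi> a) (\<rho> c) | a c. True})"

text \<open>
  \<open>S\<close> is the slice map \<open>id \<otimes> \<nu>\<close>: the unique continuous linear map on the spatial tensor product
  with \<open>a \<otimes> c \<mapsto> \<nu>(c) a\<close>.
\<close>

definition slice_map ::
    "('a::cstar_algebra \<Rightarrow> 'i op) \<Rightarrow> ('c::cstar_algebra \<Rightarrow> 'j op) \<Rightarrow> ('c \<Rightarrow> complex) \<Rightarrow>
     (('i \<times> 'j) op \<Rightarrow> 'a) \<Rightarrow> bool" where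
  "slice_map \<pi> \<rho> \<nu> S \<longleftrightarrow>
     continuous_on (spatial_tensor \<pi> \<rho>) S \<and>
     (\<forall>s\<in>spatial_tensor \<pi> \<rho>. \<forall>t\<in>spatial_tensor \<pi> \<rho>. S (s + t) = S s + S t) \<and>
     (\<forall>k. \<forall>t\<in>spatial_tensor \<pi> \<rho>. S (k *\<^sub>C t) = k *\<^sub>C S t) \<and>
     (\<forall>a c. S (op_tensor (\<pi> a) (\<rho> c)) = \<nu> c *\<^sub>C a)"

section \<open>Random quantum maps\<close>

text \<open>
  A random quantum map from \<open>B\<close> to \<open>A\<close> with parameter-algebra \<open>C\<close>.  As the spatial tensor product
  is an algebra of operators, a morphism \<open>B \<rightarrow> A \<otimes> C\<close> is a representation with values in it.
\<close>

definition random_quantum_map ::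
    "('a::cstar_algebra \<Rightarrow> 'i op) \<Rightarrow> ('c::cstar_algebra \<Rightarrow> 'j op) \<Rightarrow>
     ('b::cstar_algebra \<Rightarrow> ('i \<times> 'j) op) \<Rightarrow> ('c \<Rightarrow> complex) \<Rightarrow> bool" where
  "random_quantum_map \<pi> \<rho> \<phi> \<nu> \<longleftrightarrow>
     faithful_representation \<pi> \<and> faithful_representation \<rho> \<and>
     representation \<phi> \<and> range \<phi> \<subseteq> spatial_tensor \<pi> \<rho> \<and> state \<nu>"

definition classical_random_quantum_map ::
    "('a::cstar_algebra \<Rightarrow> 'i op) \<Rightarrow> ('c::cstar_algebra \<Rightarrow> 'j op) \<Rightarrow>
     ('b::cstar_algebra \<Rightarrow> ('i \<times> 'j) op) \<Rightarrow> ('c \<Rightarrow> complex) \<Rightarrow> bool" where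
  "classical_random_quantum_map \<pi> \<rho> \<phi> \<nu> \<longleftrightarrow>
     random_quantum_map \<pi> \<rho> \<phi> \<nu> \<and> (\<forall>c d :: 'c. c * d = d * c)"

definition implements_operator ::
    "('a::cstar_algebra \<Rightarrow> 'i op) \<Rightarrow> ('c::cstar_algebra \<Rightarrow> 'j op) \<Rightarrow>
     ('b::cstar_algebra \<Rightarrow> ('i \<times> 'j) op) \<Rightarrow> ('c \<Rightarrow> complex) \<Rightarrow> ('b \<Rightarrow> 'a) \<Rightarrow> bool" where
  "implements_operator \<pi> \<rho> \<phi> \<nu> F \<longleftrightarrow> (\<exists>S. slice_map \<pi> \<rho> \<nu> S \<and> (\<forall>b. F b = S (\<phi> b)))"

section \<open>Kernels and random continuous maps\<close>

definition regular_measure :: "'y::topological_space measure \<Rightarrow> bool" where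
  "regular_measure \<mu> \<longleftrightarrow> (\<forall>E\<in>sets borel.
     emeasure \<mu> E = (INF U\<in>{U. open U \<and> E \<subseteq> U}. emeasure \<mu> U) \<and>
     emeasure \<mu> E = (SUP L\<in>{L. compact L \<and> L \<subseteq> E}. emeasure \<mu> L))"

definition prob_measures :: "'y::topological_space measure set" where
  "prob_measures = {\<mu>. sets \<mu> = sets borel \<and> prob_space \<mu> \<and> regular_measure \<mu>}"

text \<open>
  The weak*-topology on \<open>prob_measures\<close> is the initial topology of the maps
  \<open>\<mu> \<mapsto> \<integral>f d\<mu>\<close>, so weak*-continuity is continuity of all \<open>x \<mapsto> \<integral>f d(K x)\<close>.  For a compact
  space \<open>'y\<close> the type \<open>'y \<Rightarrow>\<^sub>C complex\<close> contains every continuous \<open>f\<close>.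
\<close>

definition kernel :: "('x::topological_space \<Rightarrow> 'y::topological_space measure) \<Rightarrow> bool" where
  "kernel K \<longleftrightarrow> range K \<subseteq> prob_measures \<and>
     (\<forall>f :: 'y \<Rightarrow>\<^sub>C complex. continuous_on UNIV (\<lambda>x. \<integral>y. apply_bcontfun f y \<partial>K x))"

definition feller_markov ::
    "('x::topological_space \<Rightarrow> 'y::topological_space measure) \<Rightarrow> ('y \<Rightarrow>\<^sub>C complex) \<Rightarrow> 'x \<Rightarrow>\<^sub>C complex" where
  "feller_markov K f = Bcontfun (\<lambda>x. \<integral>y. apply_bcontfun f y \<partial>K x)"

definition random_continuous_map ::
    "('x::topological_space \<times> 'z::t2_space \<Rightarrow> 'y::topological_space) \<Rightarrow> 'z measure \<Rightarrow> bool" where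
  "random_continuous_map \<phi> \<nu> \<longleftrightarrow>
     compact (UNIV :: 'z set) \<and> sets \<nu> = sets borel \<and> prob_space \<nu> \<and> continuous_on UNIV \<phi>"

definition implements_kernel ::
    "('x::topological_space \<times> 'z::t2_space \<Rightarrow> 'y::topological_space) \<Rightarrow> 'z measure \<Rightarrow>
     ('x \<Rightarrow> 'y measure) \<Rightarrow> bool" where
  "implements_kernel \<phi> \<nu> K \<longleftrightarrow>
     (\<forall>x. \<forall>E\<in>sets borel. emeasure (K x) E = emeasure \<nu> {z. \<phi> (x, z) \<in> E})"

end

theory Submission
  imports Defs
begin

text \<open>
  Write \<open>X = [0,1]\<close> and \<open>Y = {0,1}\<close>.  A random continuous map gives, for each parameter \<open>z\<close>, a
  continuous map from the connected space \<open>X\<close> to the discrete space \<open>Y\<close>.  It is constant, so the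
  implemented kernel is constant, which the present one is not.

  The classical case is the same argument in algebraic form.  The image \<open>p\<close> of the indicator
  function of 0 is a projection in \<open>C(X) \<otimes> C\<close>, a norm-continuous path of projections in \<open>C\<close>.  If
  \<open>C\<close> is commutative, two of these commute and have distance 0 or 1, so the path is constant by
  connectedness, whereas its slice along \<open>\<nu>\<close> has to be \<open>x \<mapsto> x\<close>.  To avoid spectral theory this is
  carried out for an element \<open>t\<close> of the algebraic tensor product close to \<open>p\<close>
  (\<open>slice_of_projection_not_coordinate\<close>).  Evaluation of \<open>t\<close> at a point \<open>x\<close> is obtained from
  approximate eigenvectors: any faithful representation of \<open>C(X)\<close> has unit vectors on which every
  function acts almost as its value at \<open>x\<close> (\<open>approx_eigenvectors_exist\<close>), and freezing the first
  tensor factor along them is multiplicative and contractive (\<open>slices_to\<close>).  The alternative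
  "distance 0 or 1" becomes \<open>almost_idempotent_gap\<close>: commuting elements \<open>g\<close>, \<open>h\<close> that are almost
  idempotent have a difference \<open>d\<close> with \<open>d\<^sup>3\<close> close to \<open>d\<close>, and \<open>\<parallel>d\<^sup>2\<parallel> = \<parallel>d\<parallel>\<^sup>2\<close> because \<open>d\<close> is normal.

  With \<open>2 \<times> 2\<close> matrices the projections need not commute, and the projection onto the line spanned
  by \<open>(\<surd>x, \<surd>(1 - x))\<close> depends continuously on \<open>x\<close> and has upper left entry \<open>x\<close>.  It defines a
  random quantum map (\<open>path_projection\<close>) which implements the operator through the vector state
  \<open>A \<mapsto> A\<^sub>1\<^sub>1\<close>; here \<open>C(X)\<close> acts by multiplication on square-summable families indexed by the points
  of \<open>X\<close>, and the slice map reads off diagonal matrix coefficients (\<open>slice_map_corner\<close>).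
\<close>

section \<open>Square-summable families: basis vectors, rows and tensors\<close>

lemma ell2_eqI: "(\<And>i. ell2_nth x i = ell2_nth y i) \<Longrightarrow> x = y"
  by (simp add: fun_eq_iff flip: ell2_nth_inject)

lemma minus_ell2_nth: "ell2_nth (x - y) i = ell2_nth x i - ell2_nth y i"
  unfolding minus_ell2_def plus_ell2.rep_eq uminus_ell2.rep_eq by simp

lemma ell2_norm_has_sum: "((\<lambda>i. (cmod (ell2_nth x i))\<^sup>2) has_sum (norm x)\<^sup>2) UNIV"
proof -
  have "(norm x)\<^sup>2 = (\<Sum>\<^sub>\<infinity>i. (cmod (ell2_nth x i))\<^sup>2)"
    unfolding power2_norm_eq_inner inner_ell2_def cinner_self by simp
  then show ?thesis
    using has_sum_infsum[OF ell2_summable[of x]] by simp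
qed

lemma cmod_nth_le_norm: "cmod (ell2_nth x k) \<le> norm x"
proof -
  have "(\<Sum>i\<in>{k}. (cmod (ell2_nth x i))\<^sup>2) \<le> (norm x)\<^sup>2"
    by (rule finite_sum_le_has_sum[OF ell2_norm_has_sum]) auto
  then show ?thesis
    by (simp add: power2_le_iff_abs_le)
qed

lift_definition basis_vec :: "'i \<Rightarrow> 'i ell2" is "\<lambda>k i. if i = k then 1 else 0"
proof -
  fix k :: 'i
  have "(\<lambda>i. (cmod (if i = k then 1 else 0))\<^sup>2) summable_on {k}"
    by (rule summable_on_finite) simp
  then show "(\<lambda>i. (cmod (if i = k then 1 else 0))\<^sup>2) summable_on UNIV"
    by (rule summable_on_cong_neutral[THEN iffD1, rotated -1]) auto
qed

lemma norm_basis_vec [simp]: "norm (basis_vec k) = 1"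
proof -
  have "((\<lambda>i. (cmod (ell2_nth (basis_vec k) i))\<^sup>2) has_sum 1) {k}"
    by (rule has_sum_finiteI) (simp_all add: basis_vec.rep_eq)
  then have "((\<lambda>i. (cmod (ell2_nth (basis_vec k) i))\<^sup>2) has_sum 1) UNIV"
    by (rule has_sum_cong_neutral[THEN iffD1, rotated -1]) (auto simp: basis_vec.rep_eq)
  from has_sum_unique[OF this ell2_norm_has_sum]
  have "(norm (basis_vec k))\<^sup>2 = 1" by simp
  then show ?thesis by (simp add: power2_eq_1_iff) (metis norm_ge_zero not_one_le_zero neg_0_le_iff_le)
qed

lemma ell2_basis_expansion:
  "((\<lambda>k. ell2_nth x k *\<^sub>C basis_vec k) has_sum x) UNIV"
proof -
  have rest: "(norm (x - (\<Sum>k\<in>F. ell2_nth x k *\<^sub>C basis_vec k)))\<^sup>2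
      = (norm x)\<^sup>2 - (\<Sum>k\<in>F. (cmod (ell2_nth x k))\<^sup>2)" if "finite F" for F
  proof -
    have nth_sum: "ell2_nth (\<Sum>k\<in>G. ell2_nth x k *\<^sub>C basis_vec k) i
        = (if i \<in> G then ell2_nth x i else 0)" if "finite G" for G i
      using that
      by (induction G)
         (auto simp: zero_ell2.rep_eq plus_ell2.rep_eq scaleC_ell2.rep_eq basis_vec.rep_eq)
    let ?r = "x - (\<Sum>k\<in>F. ell2_nth x k *\<^sub>C basis_vec k)"
    have F: "((\<lambda>k. (cmod (ell2_nth x k))\<^sup>2) has_sum (\<Sum>k\<in>F. (cmod (ell2_nth x k))\<^sup>2)) F"
      using that by (rule has_sum_finite)
    have "((\<lambda>k. (cmod (ell2_nth x k))\<^sup>2) has_sum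
        ((norm x)\<^sup>2 - (\<Sum>k\<in>F. (cmod (ell2_nth x k))\<^sup>2))) (UNIV - F)"
      by (rule has_sum_Diff[OF ell2_norm_has_sum F]) simp
    then have "((\<lambda>k. (cmod (ell2_nth ?r k))\<^sup>2) has_sum
        ((norm x)\<^sup>2 - (\<Sum>k\<in>F. (cmod (ell2_nth x k))\<^sup>2))) UNIV"
      by (rule has_sum_cong_neutral[THEN iffD1, rotated -1])
         (auto simp: minus_ell2_nth nth_sum[OF that])
    from has_sum_unique[OF this ell2_norm_has_sum] show ?thesis by simp
  qed
  have "((\<lambda>F. (norm x)\<^sup>2 - (\<Sum>k\<in>F. (cmod (ell2_nth x k))\<^sup>2)) \<longlongrightarrow> (norm x)\<^sup>2 - (norm x)\<^sup>2)
      (finite_subsets_at_top UNIV)"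
    using ell2_norm_has_sum[of x] unfolding has_sum_def by (intro tendsto_intros)
  then have "((\<lambda>F. (norm (x - (\<Sum>k\<in>F. ell2_nth x k *\<^sub>C basis_vec k)))\<^sup>2) \<longlongrightarrow> 0)
      (finite_subsets_at_top UNIV)"
    unfolding diff_self
    by (rule Lim_transform_eventually) (auto intro!: eventually_finite_subsets_at_top_weakI simp: rest)
  then have "((\<lambda>F. sqrt ((norm (x - (\<Sum>k\<in>F. ell2_nth x k *\<^sub>C basis_vec k)))\<^sup>2)) \<longlongrightarrow> sqrt 0)
      (finite_subsets_at_top UNIV)"
    by (rule tendsto_real_sqrt)
  then show ?thesis
    unfolding has_sum_def
    by (subst tendsto_dist_iff) (simp add: dist_norm norm_minus_commute)
qed

text \<open>
  Complex-linear operators are determined by the basis; this is the uniqueness half of the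
  definite description in \<^const>\<open>op_tensor\<close>.
\<close>

lemma complex_linear_eqI:
  assumes "complex_linear S" "complex_linear T"
    and eq: "\<And>k. blinfun_apply S (basis_vec k) = blinfun_apply T (basis_vec k)"
  shows "S = T"
proof (rule blinfun_eqI)
  fix x
  have "((\<lambda>k. blinfun_apply S (ell2_nth x k *\<^sub>C basis_vec k)) has_sum blinfun_apply S x) UNIV"
    "((\<lambda>k. blinfun_apply T (ell2_nth x k *\<^sub>C basis_vec k)) has_sum blinfun_apply T x) UNIV"
    by (rule has_sum_bounded_linear[OF blinfun.bounded_linear_right ell2_basis_expansion, unfolded o_def])+
  moreover have "blinfun_apply S (ell2_nth x k *\<^sub>C basis_vec k)
      = blinfun_apply T (ell2_nth x k *\<^sub>C basis_vec k)" for k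
    using assms by (simp add: complex_linear_def)
  ultimately show "blinfun_apply S x = blinfun_apply T x"
    by (simp add: has_sum_unique)
qed

lift_definition row :: "('i \<times> 'j) ell2 \<Rightarrow> 'i \<Rightarrow> 'j ell2" is "\<lambda>f i j. f (i, j)"
proof -
  fix f :: "'i \<times> 'j \<Rightarrow> complex" and i
  assume "(\<lambda>p. (cmod (f p))\<^sup>2) summable_on UNIV"
  then have "(\<lambda>(i, j). (cmod (f (i, j)))\<^sup>2) summable_on UNIV \<times> UNIV"
    by (simp add: case_prod_unfold)
  then show "(\<lambda>j. (cmod (f (i, j)))\<^sup>2) summable_on UNIV"
    by (rule summable_on_SigmaD1[of "\<lambda>i j. (cmod (f (i, j)))\<^sup>2"]) simp
qed

lemma row_norm_has_sum: "((\<lambda>i. (norm (row x i))\<^sup>2) has_sum (norm x)\<^sup>2) UNIV"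
proof -
  have "((\<lambda>p. (cmod (ell2_nth x p))\<^sup>2) has_sum (norm x)\<^sup>2) (UNIV \<times> UNIV)"
    using ell2_norm_has_sum[of x] by simp
  from has_sum_SigmaD[OF this, of "\<lambda>i. (norm (row x i))\<^sup>2"] show ?thesis
    using ell2_norm_has_sum[of "row x i" for i] by (simp add: row.rep_eq)
qed

lemma rows_summable:
  assumes "(\<lambda>i. (norm (r i))\<^sup>2) summable_on UNIV"
  shows "(\<lambda>p. (cmod (ell2_nth (r (fst p)) (snd p)))\<^sup>2) summable_on UNIV"
proof -
  have "(\<lambda>p. (cmod (ell2_nth (r (fst p)) (snd p)))\<^sup>2) summable_on UNIV \<times> UNIV"
    by (rule summable_on_SigmaI[where g = "\<lambda>i. (norm (r i))\<^sup>2"])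
       (use assms ell2_norm_has_sum in auto)
  then show ?thesis by simp
qed

lemma ell2_tensor_nth: "ell2_nth (x \<otimes>\<^sub>2 y) (i, j) = ell2_nth x i * ell2_nth y j"
  by (simp add: ell2_tensor.rep_eq)

lemma ell2_pair_eqI: "(\<And>i j. ell2_nth x (i, j) = ell2_nth y (i, j)) \<Longrightarrow> x = y"
  by (rule ell2_eqI) (metis surj_pair)

lemma norm_ell2_tensor: "norm (x \<otimes>\<^sub>2 y) = norm x * norm y"
proof -
  have "row (x \<otimes>\<^sub>2 y) i = ell2_nth x i *\<^sub>C y" for i
    by (rule ell2_eqI) (simp add: row.rep_eq ell2_tensor_nth scaleC_ell2.rep_eq)
  then have "((\<lambda>i. (cmod (ell2_nth x i))\<^sup>2 * (norm y)\<^sup>2) has_sum (norm (x \<otimes>\<^sub>2 y))\<^sup>2) UNIV"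
    using row_norm_has_sum[of "x \<otimes>\<^sub>2 y"] by (simp add: norm_scaleC power_mult_distrib)
  moreover have "((\<lambda>i. (cmod (ell2_nth x i))\<^sup>2 * (norm y)\<^sup>2) has_sum ((norm x)\<^sup>2 * (norm y)\<^sup>2)) UNIV"
    by (rule has_sum_cmult_left[OF ell2_norm_has_sum])
  ultimately have "(norm (x \<otimes>\<^sub>2 y))\<^sup>2 = (norm x * norm y)\<^sup>2"
    using has_sum_unique by (fastforce simp: power_mult_distrib)
  then show ?thesis
    by (rule power2_eq_imp_eq) simp_all
qed

lemma ell2_tensor_diff_left: "(x - y) \<otimes>\<^sub>2 z = x \<otimes>\<^sub>2 z - y \<otimes>\<^sub>2 z"
  by (rule ell2_pair_eqI) (simp only: minus_ell2_nth ell2_tensor_nth left_diff_distrib)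

lemma ell2_tensor_add_right: "x \<otimes>\<^sub>2 (y + z) = x \<otimes>\<^sub>2 y + x \<otimes>\<^sub>2 z"
  by (rule ell2_pair_eqI) (simp only: plus_ell2.rep_eq ell2_tensor_nth distrib_left)

lemma ell2_tensor_scaleR_right: "x \<otimes>\<^sub>2 (r *\<^sub>R y) = r *\<^sub>R (x \<otimes>\<^sub>2 y)"
  by (rule ell2_pair_eqI) (simp add: scaleR_ell2.rep_eq ell2_tensor_nth)

lemma ell2_tensor_scaleC_left: "(c *\<^sub>C x) \<otimes>\<^sub>2 y = x \<otimes>\<^sub>2 (c *\<^sub>C y)"
  by (rule ell2_pair_eqI) (simp add: scaleC_ell2.rep_eq ell2_tensor_nth)

lemma basis_vec_pair: "basis_vec (i, j) = basis_vec i \<otimes>\<^sub>2 basis_vec j"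
  by (rule ell2_pair_eqI) (simp add: basis_vec.rep_eq ell2_tensor_nth)

section \<open>Tensor products of operators\<close>

lift_definition ell2_flip :: "('i \<times> 'j) ell2 \<Rightarrow> ('j \<times> 'i) ell2" is "\<lambda>f p. f (prod.swap p)"
proof -
  fix f :: "'i \<times> 'j \<Rightarrow> complex"
  assume "(\<lambda>p. (cmod (f p))\<^sup>2) summable_on UNIV"
  then show "(\<lambda>p. (cmod (f (prod.swap p)))\<^sup>2) summable_on UNIV"
    by (rule summable_on_reindex_bij_betw[OF bij_swap, THEN iffD2])
qed

lemma norm_ell2_flip: "norm (ell2_flip x) = norm x"
proof -
  have "((\<lambda>p. (cmod (ell2_nth x (prod.swap p)))\<^sup>2) has_sum (norm x)\<^sup>2) UNIV"
    by (rule has_sum_reindex_bij_betw[OF bij_swap, THEN iffD2, OF ell2_norm_has_sum])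
  from has_sum_unique[OF this ell2_norm_has_sum[of "ell2_flip x", unfolded ell2_flip.rep_eq]]
  have "(norm (ell2_flip x))\<^sup>2 = (norm x)\<^sup>2" by simp
  then show ?thesis by (rule power2_eq_imp_eq) simp_all
qed

lift_definition flip_op :: "('i \<times> 'j) ell2 \<Rightarrow>\<^sub>L ('j \<times> 'i) ell2" is ell2_flip
  by (rule bounded_linear_intro[where K = 1])
     (auto simp: norm_ell2_flip intro!: ell2_eqI
       simp: ell2_flip.rep_eq plus_ell2.rep_eq scaleR_ell2.rep_eq)

lemma norm_flip_op: "norm flip_op \<le> 1"
  by (rule norm_blinfun_bound) (simp_all add: flip_op.rep_eq norm_ell2_flip)

lemma op_rows_summable:
  "(\<lambda>i. (norm (blinfun_apply T (row x i)))\<^sup>2) summable_on UNIV"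
proof (rule summable_on_comparison_test)
  show "(\<lambda>i. (norm T)\<^sup>2 * (norm (row x i))\<^sup>2) summable_on UNIV"
    by (intro summable_on_cmult_right has_sum_imp_summable[OF row_norm_has_sum])
  show "(norm (blinfun_apply T (row x i)))\<^sup>2 \<le> (norm T)\<^sup>2 * (norm (row x i))\<^sup>2" for i
    unfolding power_mult_distrib[symmetric] by (intro power_mono norm_blinfun) simp
qed simp

definition amplify_fun :: "'j op \<Rightarrow> ('i \<times> 'j) ell2 \<Rightarrow> ('i \<times> 'j) ell2" where
  "amplify_fun T x = Abs_ell2 (\<lambda>p. ell2_nth (blinfun_apply T (row x (fst p))) (snd p))"

lemma amplify_fun_nth:
  "ell2_nth (amplify_fun T x) (i, j) = ell2_nth (blinfun_apply T (row x i)) j"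
  unfolding amplify_fun_def
  by (subst Abs_ell2_inverse) (simp_all add: rows_summable[OF op_rows_summable])

lemma row_amplify_fun: "row (amplify_fun T x) i = blinfun_apply T (row x i)"
  by (rule ell2_eqI) (simp add: row.rep_eq amplify_fun_nth)

lemma row_add: "row (x + y) i = row x i + row y i"
  by (rule ell2_eqI) (simp add: row.rep_eq plus_ell2.rep_eq)

lemma row_scaleR: "row (r *\<^sub>R x) i = r *\<^sub>R row x i"
  by (rule ell2_eqI) (simp add: row.rep_eq scaleR_ell2.rep_eq)

lemma row_scaleC: "row (c *\<^sub>C x) i = c *\<^sub>C row x i"
  by (rule ell2_eqI) (simp add: row.rep_eq scaleC_ell2.rep_eq)

lemma norm_amplify_fun: "norm (amplify_fun T x) \<le> norm T * norm x"
proof -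
  have "(norm (amplify_fun T x))\<^sup>2 \<le> (norm T)\<^sup>2 * (norm x)\<^sup>2"
  proof (rule has_sum_mono)
    show "((\<lambda>i. (norm (blinfun_apply T (row x i)))\<^sup>2) has_sum (norm (amplify_fun T x))\<^sup>2) UNIV"
      using row_norm_has_sum[of "amplify_fun T x"] by (simp add: row_amplify_fun)
    show "((\<lambda>i. (norm T)\<^sup>2 * (norm (row x i))\<^sup>2) has_sum (norm T)\<^sup>2 * (norm x)\<^sup>2) UNIV"
      by (rule has_sum_cmult_right[OF row_norm_has_sum])
    show "(norm (blinfun_apply T (row x i)))\<^sup>2 \<le> (norm T)\<^sup>2 * (norm (row x i))\<^sup>2" for i
      unfolding power_mult_distrib[symmetric] by (intro power_mono norm_blinfun) simp
  qed
  then show ?thesis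
    by (metis mult_nonneg_nonneg norm_ge_zero power2_le_imp_le power_mult_distrib)
qed

lift_definition amplify :: "'j op \<Rightarrow> ('i \<times> 'j) op" is amplify_fun
proof (rule bounded_linear_intro)
  fix T :: "'j op" and x y :: "('i \<times> 'j) ell2" and r :: real
  show "amplify_fun T (x + y) = amplify_fun T x + amplify_fun T y"
    by (rule ell2_pair_eqI)
       (simp add: amplify_fun_nth row_add blinfun.add_right plus_ell2.rep_eq)
  show "amplify_fun T (r *\<^sub>R x) = r *\<^sub>R amplify_fun T x"
    by (rule ell2_pair_eqI)
       (simp add: amplify_fun_nth row_scaleR blinfun.scaleR_right scaleR_ell2.rep_eq)
  show "norm (amplify_fun T x) \<le> norm x * norm T"
    using norm_amplify_fun[of T x] by (simp add: mult.commute)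
qed

lemma norm_amplify: "norm (amplify T) \<le> norm T"
  by (rule norm_blinfun_bound) (simp_all add: amplify.rep_eq norm_amplify_fun)

text \<open>
  \<open>S \<otimes> T = (S \<otimes> 1)(1 \<otimes> T)\<close>, where \<open>1 \<otimes> T\<close> acts on rows and \<open>S \<otimes> 1\<close> is its conjugate by
  the flip.
\<close>

definition tensor_witness :: "'i op \<Rightarrow> 'j op \<Rightarrow> ('i \<times> 'j) op" where
  "tensor_witness S T = (flip_op o\<^sub>L amplify S o\<^sub>L flip_op) o\<^sub>L amplify T"

lemma tensor_witness_nth:
  "ell2_nth (blinfun_apply (tensor_witness S T) x) (i, j) =
     ell2_nth (blinfun_apply S (row (ell2_flip (amplify_fun T x)) j)) i"
  by (simp add: tensor_witness_def flip_op.rep_eq ell2_flip.rep_eq amplify.rep_eq amplify_fun_nth)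

lemma tensor_witness:
  assumes S: "complex_linear S" and T: "complex_linear T"
  shows "complex_linear (tensor_witness S T)"
    and "blinfun_apply (tensor_witness S T) (\<xi> \<otimes>\<^sub>2 \<eta>) = blinfun_apply S \<xi> \<otimes>\<^sub>2 blinfun_apply T \<eta>"
proof -
  have 1: "amplify_fun T (c *\<^sub>C x) = c *\<^sub>C amplify_fun T x" for c and x :: "('a \<times> 'b) ell2"
    using T by (intro ell2_pair_eqI)
      (auto simp: amplify_fun_nth row_scaleC complex_linear_def scaleC_ell2.rep_eq)
  have 2: "ell2_flip (c *\<^sub>C x) = c *\<^sub>C ell2_flip x" for c and x :: "('a \<times> 'b) ell2"
    by (rule ell2_eqI) (simp add: ell2_flip.rep_eq scaleC_ell2.rep_eq)
  show "complex_linear (tensor_witness S T)"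
    using S unfolding complex_linear_def
    by (auto intro!: ell2_pair_eqI simp: tensor_witness_nth 1 2 row_scaleC scaleC_ell2.rep_eq)
  have "row (\<xi> \<otimes>\<^sub>2 \<eta>) i = ell2_nth \<xi> i *\<^sub>C \<eta>" for i
    by (rule ell2_eqI) (simp add: row.rep_eq ell2_tensor_nth scaleC_ell2.rep_eq)
  then have "amplify_fun T (\<xi> \<otimes>\<^sub>2 \<eta>) = \<xi> \<otimes>\<^sub>2 blinfun_apply T \<eta>"
    using T by (intro ell2_pair_eqI)
      (auto simp: amplify_fun_nth complex_linear_def scaleC_ell2.rep_eq ell2_tensor_nth)
  moreover have "row (ell2_flip (\<xi> \<otimes>\<^sub>2 \<zeta>)) j = ell2_nth \<zeta> j *\<^sub>C \<xi>" for \<zeta> :: "'b ell2" and j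
    by (rule ell2_eqI)
       (simp add: row.rep_eq ell2_tensor_nth scaleC_ell2.rep_eq ell2_flip.rep_eq mult.commute)
  ultimately show "blinfun_apply (tensor_witness S T) (\<xi> \<otimes>\<^sub>2 \<eta>)
      = blinfun_apply S \<xi> \<otimes>\<^sub>2 blinfun_apply T \<eta>"
    using S by (intro ell2_pair_eqI)
      (auto simp: tensor_witness_nth complex_linear_def scaleC_ell2.rep_eq ell2_tensor_nth)
qed

lemma op_tensor_eq:
  assumes "complex_linear S" "complex_linear T"
  shows "op_tensor S T = tensor_witness S T"
  unfolding op_tensor_def
proof (rule the_equality)
  show "complex_linear (tensor_witness S T) \<and>
    (\<forall>\<xi> \<eta>. blinfun_apply (tensor_witness S T) (\<xi> \<otimes>\<^sub>2 \<eta>) = blinfun_apply S \<xi> \<otimes>\<^sub>2 blinfun_apply T \<eta>)"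
    using tensor_witness[OF assms] by blast
  show "W = tensor_witness S T"
    if "complex_linear W \<and>
      (\<forall>\<xi> \<eta>. blinfun_apply W (\<xi> \<otimes>\<^sub>2 \<eta>) = blinfun_apply S \<xi> \<otimes>\<^sub>2 blinfun_apply T \<eta>)" for W
  proof (rule complex_linear_eqI)
    show "blinfun_apply W (basis_vec k) = blinfun_apply (tensor_witness S T) (basis_vec k)" for k
      using that tensor_witness(2)[OF assms] by (cases k) (simp add: basis_vec_pair)
  qed (use that tensor_witness(1)[OF assms] in auto)
qed

lemma op_tensor_apply:
  assumes "complex_linear S" "complex_linear T"
  shows "blinfun_apply (op_tensor S T) (\<xi> \<otimes>\<^sub>2 \<eta>) = blinfun_apply S \<xi> \<otimes>\<^sub>2 blinfun_apply T \<eta>"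
  using assms by (simp add: op_tensor_eq tensor_witness)

lemma complex_linear_op_tensor:
  "complex_linear S \<Longrightarrow> complex_linear T \<Longrightarrow> complex_linear (op_tensor S T)"
  by (simp add: op_tensor_eq tensor_witness)

lemma norm_op_tensor:
  fixes S :: "'i op" and T :: "'j op"
  assumes "complex_linear S" "complex_linear T"
  shows "norm (op_tensor S T) \<le> norm S * norm T"
proof -
  have le: "norm (A o\<^sub>L B) \<le> a * b" if "norm A \<le> a" "norm B \<le> b"
    for A :: "'y::real_normed_vector \<Rightarrow>\<^sub>L 'z::real_normed_vector"
      and B :: "'x::real_normed_vector \<Rightarrow>\<^sub>L 'y" and a b
    using norm_blinfun_compose[of A B] that
    by (meson mult_mono norm_ge_zero order_trans)
  have "norm (tensor_witness S T) \<le> (1 * norm S * 1) * norm T"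
    unfolding tensor_witness_def by (intro le norm_flip_op norm_amplify)
  then show ?thesis using op_tensor_eq[OF assms] by simp
qed

section \<open>Norm estimates for representations\<close>

lemma complex_linear_rep: "representation \<pi> \<Longrightarrow> complex_linear (\<pi> a)"
  and rep_add: "representation \<pi> \<Longrightarrow> \<pi> (a + b) = \<pi> a + \<pi> b"
  and rep_scaleC: "representation \<pi> \<Longrightarrow> \<pi> (c *\<^sub>C a) = c *\<^sub>C \<pi> a"
  and rep_mult: "representation \<pi> \<Longrightarrow> \<pi> (a * b) = \<pi> a o\<^sub>L \<pi> b"
  and rep_one: "representation \<pi> \<Longrightarrow> \<pi> 1 = id_blinfun"
  and rep_adjoint: "representation \<pi> \<Longrightarrow>
    cinner (blinfun_apply (\<pi> (star a)) \<xi>) \<eta> = cinner \<xi> (blinfun_apply (\<pi> a) \<eta>)"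
  by (simp_all add: representation_def)

lemma rep_diff: "representation \<pi> \<Longrightarrow> \<pi> (a - b) = \<pi> a - \<pi> b"
  using rep_add[of \<pi> "a - b" b] by (simp add: algebra_simps)

lemma rep_zero: "representation \<pi> \<Longrightarrow> \<pi> 0 = 0"
  using rep_diff[of \<pi> 0 0] by simp

lemma rep_scaleR: "representation \<pi> \<Longrightarrow> \<pi> (r *\<^sub>R a) = r *\<^sub>R \<pi> a"
  using rep_scaleC[of \<pi> "complex_of_real r" a] by (simp add: scaleC_of_real)

lemma rep_norm_apply:
  assumes "representation \<pi>"
  shows "(norm (blinfun_apply (\<pi> c) \<xi>))\<^sup>2 = inner \<xi> (blinfun_apply (\<pi> (star c * c)) \<xi>)"
proof -
  have "cinner (blinfun_apply (\<pi> c) \<xi>) (blinfun_apply (\<pi> c) \<xi>)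
      = cinner \<xi> (blinfun_apply (\<pi> (star c)) (blinfun_apply (\<pi> c) \<xi>))"
    using rep_adjoint[OF assms, of "star c" \<xi>] by (simp add: star_star)
  then show ?thesis
    by (simp add: power2_norm_eq_inner inner_ell2_def rep_mult[OF assms])
qed

lemma rep_norm_square:
  assumes "representation \<pi>"
  shows "(norm (\<pi> c))\<^sup>2 \<le> norm (\<pi> (star c * c))"
proof -
  have "norm (\<pi> c) \<le> sqrt (norm (\<pi> (star c * c)))"
  proof (rule norm_blinfun_bound)
    fix \<xi>
    have "(norm (blinfun_apply (\<pi> c) \<xi>))\<^sup>2 \<le> norm \<xi> * norm (blinfun_apply (\<pi> (star c * c)) \<xi>)"
      unfolding rep_norm_apply[OF assms] by (rule norm_cauchy_schwarz)
    also have "\<dots> \<le> norm \<xi> * (norm (\<pi> (star c * c)) * norm \<xi>)"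
      by (intro mult_left_mono norm_blinfun) simp
    finally have "norm (blinfun_apply (\<pi> c) \<xi>) \<le> sqrt (norm (\<pi> (star c * c)) * (norm \<xi>)\<^sup>2)"
      by (intro real_le_rsqrt) (simp add: power2_eq_square mult_ac)
    then show "norm (blinfun_apply (\<pi> c) \<xi>) \<le> sqrt (norm (\<pi> (star c * c))) * norm \<xi>"
      by (simp add: real_sqrt_mult)
  qed simp
  then show ?thesis
    by (metis norm_ge_zero real_sqrt_ge_zero real_sqrt_pow2 power_mono)
qed

lemma rep_norm_mult: "representation \<pi> \<Longrightarrow> norm (\<pi> (a * b)) \<le> norm (\<pi> a) * norm (\<pi> b)"
  by (simp add: rep_mult norm_blinfun_compose)

lemma rep_norm_star_le:
  assumes "representation \<pi>"
  shows "norm (\<pi> (star c)) \<le> norm (\<pi> c)"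
proof (cases "norm (\<pi> (star c)) = 0")
  case False
  have "norm (\<pi> (star c)) * norm (\<pi> (star c)) \<le> norm (\<pi> c) * norm (\<pi> (star c))"
    using rep_norm_square[OF assms, of "star c"] rep_norm_mult[OF assms, of c "star c"]
    by (simp add: star_star power2_eq_square)
  then show ?thesis using False by simp
qed (metis norm_ge_zero)

text \<open>
  Every element of a commutative algebra is normal, so the C*-identity, applied to \<open>c\<close> and
  to \<open>star c * c\<close>, gives \<open>\<parallel>\<rho> c\<parallel>\<^sup>4 \<le> \<parallel>\<rho> ((star c * c)\<^sup>2)\<parallel> = \<parallel>\<rho> (star (c\<^sup>2) * c\<^sup>2)\<parallel> \<le> \<parallel>\<rho> (c\<^sup>2)\<parallel>\<^sup>2\<close>.
\<close>

lemma rep_norm_power2_commutative: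
  fixes \<rho> :: "'c::cstar_algebra \<Rightarrow> 'j op"
  assumes \<rho>: "representation \<rho>" and comm: "\<And>c d :: 'c. c * d = d * c"
  shows "(norm (\<rho> c))\<^sup>2 \<le> norm (\<rho> (c * c))"
proof -
  let ?N = "\<lambda>c. norm (\<rho> c)"
  define h where "h = star c * c"
  have square: "star h * h = star (c * c) * (c * c)"
    unfolding h_def star_mult star_star by (metis comm mult.assoc)
  have "((?N c)\<^sup>2)\<^sup>2 \<le> (?N h)\<^sup>2"
    unfolding h_def by (intro power_mono rep_norm_square[OF \<rho>]) simp
  also have "\<dots> \<le> ?N (star h * h)"
    by (rule rep_norm_square[OF \<rho>])
  also have "\<dots> \<le> ?N (star (c * c)) * ?N (c * c)"
    unfolding square by (rule rep_norm_mult[OF \<rho>])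
  also have "\<dots> \<le> (?N (c * c))\<^sup>2"
    unfolding power2_eq_square by (intro mult_right_mono rep_norm_star_le[OF \<rho>]) simp
  finally show ?thesis
    by (rule power2_le_imp_le) simp
qed

text \<open>
  Two commuting idempotents differ by an element \<open>d\<close> with \<open>d\<^sup>3 = d\<close>, and a normal such \<open>d\<close> has
  norm 0 or 1.  This is the version for elements that are idempotent up to \<open>\<delta>\<close>.
\<close>

lemma almost_idempotent_gap:
  fixes \<rho> :: "'c::cstar_algebra \<Rightarrow> 'j op"
  assumes \<rho>: "representation \<rho>" and comm: "\<And>c d :: 'c. c * d = d * c"
    and g: "norm (\<rho> (g * g - g)) \<le> \<delta>" "norm (\<rho> g) \<le> 2"
    and h: "norm (\<rho> (h * h - h)) \<le> \<delta>" "norm (\<rho> h) \<le> 2"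
  shows "(norm (\<rho> (g - h)))\<^sup>2 * (1 - (norm (\<rho> (g - h)))\<^sup>2) \<le> 72 * \<delta>"
proof -
  let ?N = "\<lambda>c. norm (\<rho> c)"
  define u v d where "u = g * g - g" and "v = h * h - h" and "d = g - h"
  have tri: "?N (a + b) \<le> ?N a + ?N b" for a b
    by (simp add: rep_add[OF \<rho>] norm_triangle_ineq)
  have tri': "?N (a - b) \<le> ?N a + ?N b" for a b
    by (simp add: rep_diff[OF \<rho>] norm_triangle_ineq4)
  have mult: "?N (a * b) \<le> \<alpha> * \<beta>" if "?N a \<le> \<alpha>" "?N b \<le> \<beta>" for a b \<alpha> \<beta>
    using rep_norm_mult[OF \<rho>, of a b] that by (meson mult_mono norm_ge_zero order_trans)
  have "?N u \<le> \<delta>" "?N v \<le> \<delta>" using g h by (simp_all add: u_def v_def)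
  then have bounds: "?N (g * u) \<le> 2 * \<delta>" "?N (h * v) \<le> 2 * \<delta>" "?N (u * h) \<le> \<delta> * 2"
    "?N (g * v) \<le> 2 * \<delta>"
    using g h by (intro mult; simp)+
  have lcomm: "a * (b * c) = b * (a * c)" for a b c :: 'c
    by (metis comm mult.assoc)
  have cube: "d * d * d - d
      = (u + g * u) - (v + h * v) - (u * h + (u * h + u * h)) + (g * v + (g * v + g * v))"
    unfolding u_def v_def d_def
    by (simp add: left_diff_distrib right_diff_distrib distrib_left distrib_right
        mult.assoc comm lcomm)
  have "?N (d * d * d - d) \<le> 18 * \<delta>"
    unfolding cube
    using \<open>?N u \<le> \<delta>\<close> \<open>?N v \<le> \<delta>\<close> bounds
      tri[of u "g * u"] tri[of v "h * v"] tri[of "u * h" "u * h"] tri[of "u * h" "u * h + u * h"]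
      tri[of "g * v" "g * v"] tri[of "g * v" "g * v + g * v"]
      tri'[of "u + g * u" "v + h * v"]
      tri'[of "(u + g * u) - (v + h * v)" "u * h + (u * h + u * h)"]
      tri[of "(u + g * u) - (v + h * v) - (u * h + (u * h + u * h))" "g * v + (g * v + g * v)"]
    by linarith
  moreover have "?N d \<le> 4"
    unfolding d_def using tri'[of g h] g h by linarith
  ultimately have "?N (d * (d * d * d - d)) \<le> 4 * (18 * \<delta>)"
    by (intro mult)
  moreover have "d * d = d * d * (d * d) - d * (d * d * d - d)"
    by (simp add: right_diff_distrib mult.assoc)
  then have "?N (d * d) \<le> ?N (d * d * (d * d)) + ?N (d * (d * d * d - d))"
    by (metis tri')
  moreover have "?N (d * d) \<le> ?N d * ?N d"
    by (rule rep_norm_mult[OF \<rho>])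
  then have "?N (d * d * (d * d)) \<le> (?N d * ?N d) * (?N d * ?N d)"
    by (rule mult) (rule rep_norm_mult[OF \<rho>])
  moreover have "(?N d)\<^sup>2 \<le> ?N (d * d)"
    by (rule rep_norm_power2_commutative[OF \<rho> comm])
  ultimately show ?thesis
    unfolding d_def[symmetric] by (simp add: right_diff_distrib power2_eq_square)
qed

section \<open>Approximate eigenvectors of multiplication by functions\<close>

text \<open>
  With \<open>M = \<parallel>a\<parallel>\<close> the function \<open>M\<^sup>2 - \<bar>a\<bar>\<^sup>2\<close> has a continuous square root \<open>b\<close>, and
  \<open>\<parallel>\<pi>(a)\<xi>\<parallel>\<^sup>2 + \<parallel>\<pi>(b)\<xi>\<parallel>\<^sup>2 = M\<^sup>2\<parallel>\<xi>\<parallel>\<^sup>2\<close>.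
\<close>

lemma rep_bcontfun_contractive:
  fixes \<pi> :: "('x::metric_space \<Rightarrow>\<^sub>C complex) \<Rightarrow> 'i op"
  assumes \<pi>: "representation \<pi>"
  shows "norm (\<pi> a) \<le> norm a"
proof (rule norm_blinfun_bound)
  fix \<xi>
  let ?b = "\<lambda>x. complex_of_real (sqrt ((norm a)\<^sup>2 - (cmod (apply_bcontfun a x))\<^sup>2))"
  have le: "(cmod (apply_bcontfun a x))\<^sup>2 \<le> (norm a)\<^sup>2" for x
    by (intro power_mono norm_bounded) simp
  have "?b \<in> bcontfun"
  proof (rule bcontfun_normI)
    show "continuous_on UNIV ?b"
      by (intro continuous_intros continuous_on_apply_bcontfun)
    show "norm (?b x) \<le> norm a" for x
      using le by (simp add: real_sqrt_le_iff' real_le_lsqrt)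
  qed
  then have b: "apply_bcontfun (Bcontfun ?b) = ?b"
    by (rule Bcontfun_inverse)
  have "star a * a + star (Bcontfun ?b) * Bcontfun ?b = complex_of_real ((norm a)\<^sup>2) *\<^sub>C 1"
  proof (rule bcontfun_eqI)
    fix x
    have "cnj (?b x) * ?b x = complex_of_real ((norm a)\<^sup>2 - (cmod (apply_bcontfun a x))\<^sup>2)"
      using le by (simp flip: of_real_mult)
    moreover have "cnj (apply_bcontfun a x) * apply_bcontfun a x
        = complex_of_real ((cmod (apply_bcontfun a x))\<^sup>2)"
      by (metis complex_norm_square mult.commute)
    ultimately show "apply_bcontfun (star a * a + star (Bcontfun ?b) * Bcontfun ?b) x
        = apply_bcontfun (complex_of_real ((norm a)\<^sup>2) *\<^sub>C 1) x"
      by (simp add: b plus_bcontfun.rep_eq star_complex_def scaleC_complex_def)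
  qed
  then have "\<pi> (star a * a) + \<pi> (star (Bcontfun ?b) * Bcontfun ?b) = (norm a)\<^sup>2 *\<^sub>R id_blinfun"
    by (metis rep_add[OF \<pi>] rep_scaleC[OF \<pi>] rep_one[OF \<pi>] scaleC_of_real)
  from arg_cong[OF this, of "\<lambda>T. inner \<xi> (blinfun_apply T \<xi>)"]
  have "inner \<xi> (blinfun_apply (\<pi> (star a * a)) \<xi>)
      + inner \<xi> (blinfun_apply (\<pi> (star (Bcontfun ?b) * Bcontfun ?b)) \<xi>) = (norm a)\<^sup>2 * inner \<xi> \<xi>"
    by (simp add: blinfun.add_left blinfun.scaleR_left inner_add_right)
  then have "(norm (blinfun_apply (\<pi> a) \<xi>))\<^sup>2 \<le> (norm a * norm \<xi>)\<^sup>2"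
    unfolding rep_norm_apply[OF \<pi>, symmetric] power_mult_distrib power2_norm_eq_inner[of \<xi>]
    by (smt (verit) zero_le_power2)
  then show "norm (blinfun_apply (\<pi> a) \<xi>) \<le> norm a * norm \<xi>"
    by (rule power2_le_imp_le) simp
qed simp

definition approx_eigenvectors ::
    "(('x::metric_space \<Rightarrow>\<^sub>C complex) \<Rightarrow> 'i op) \<Rightarrow> 'x \<Rightarrow> (nat \<Rightarrow> 'i ell2) \<Rightarrow> bool" where
  "approx_eigenvectors \<pi> x \<xi> \<longleftrightarrow> (\<forall>n. norm (\<xi> n) = 1) \<and>
     (\<forall>a. (\<lambda>n. blinfun_apply (\<pi> a) (\<xi> n) - apply_bcontfun a x *\<^sub>C \<xi> n) \<longlonglongrightarrow> 0)"

lift_definition tent :: "'x::metric_space \<Rightarrow> real \<Rightarrow> 'x \<Rightarrow>\<^sub>C complex"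
  is "\<lambda>x r y. complex_of_real (max 0 (1 - \<bar>r\<bar> * dist y x))"
  by (rule bcontfun_normI[where b = 1]) (auto intro!: continuous_intros)

text \<open>
  A faithful representation cannot annihilate a tent function around \<open>x\<close>.  On vectors in the
  range of a narrow tent a continuous function acts almost as its value at \<open>x\<close>: it may be
  cut off outside a small ball, where its difference from that value is small in norm.
\<close>

lemma approx_eigenvectors_exist:
  fixes \<pi> :: "('x::metric_space \<Rightarrow>\<^sub>C complex) \<Rightarrow> 'i op"
  assumes "faithful_representation \<pi>"
  shows "\<exists>\<xi>. approx_eigenvectors \<pi> x \<xi>"
proof -
  have \<pi>: "representation \<pi>" and inj: "inj \<pi>"
    using assms by (auto simp: faithful_representation_def)
  have "\<exists>\<zeta>. norm (blinfun_apply (\<pi> (tent x (real (Suc n)))) \<zeta>) = 1" for n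
  proof -
    have "apply_bcontfun (tent x (real (Suc n))) x \<noteq> apply_bcontfun 0 x"
      by (simp add: tent.rep_eq)
    then have "\<pi> (tent x (real (Suc n))) \<noteq> 0"
      using inj rep_zero[OF \<pi>] by (metis injD)
    then obtain \<eta> where \<eta>: "blinfun_apply (\<pi> (tent x (real (Suc n)))) \<eta> \<noteq> 0"
      by (metis blinfun_eqI zero_blinfun.rep_eq)
    then show ?thesis
      by (intro exI[of _ "\<eta> /\<^sub>R norm (blinfun_apply (\<pi> (tent x (real (Suc n)))) \<eta>)"])
         (simp add: blinfun.scaleR_right)
  qed
  then obtain \<zeta> where \<zeta>: "\<And>n. norm (blinfun_apply (\<pi> (tent x (real (Suc n)))) (\<zeta> n)) = 1"
    by metis
  define \<xi> where "\<xi> n = blinfun_apply (\<pi> (tent x (real (Suc n)))) (\<zeta> n)" for n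
  have "(\<lambda>n. blinfun_apply (\<pi> a) (\<xi> n) - apply_bcontfun a x *\<^sub>C \<xi> n) \<longlonglongrightarrow> 0" for a
  proof (rule LIMSEQ_I)
    fix e :: real
    assume "e > 0"
    have "isCont (apply_bcontfun a) x"
      using continuous_on_apply_bcontfun[of UNIV a] continuous_on_eq_continuous_at[OF open_UNIV]
      by blast
    then obtain d where d: "d > 0"
      and close: "\<And>y. dist y x < d \<Longrightarrow> dist (apply_bcontfun a y) (apply_bcontfun a x) < e / 2"
      using \<open>e > 0\<close> unfolding continuous_at_eps_delta by (metis half_gt_zero)
    define b where "b = a - apply_bcontfun a x *\<^sub>C 1"
    have b_apply: "apply_bcontfun b y = apply_bcontfun a y - apply_bcontfun a x" for y
      by (simp add: b_def minus_bcontfun.rep_eq scaleC_complex_def)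
    \<comment> \<open>The plateau function \<open>k\<close> is 1 within distance \<open>d/2\<close> of \<open>x\<close> and vanishes beyond \<open>d\<close>.\<close>
    let ?k = "\<lambda>y. complex_of_real (max 0 (min 1 (2 - 2 / d * dist y x)))"
    have "?k \<in> bcontfun"
      by (rule bcontfun_normI[where b = 1]) (use d in \<open>auto intro!: continuous_intros\<close>)
    define k where "k = Bcontfun ?k"
    have k: "apply_bcontfun k y = complex_of_real (max 0 (min 1 (2 - 2 / d * dist y x)))" for y
      unfolding k_def using Bcontfun_inverse[OF \<open>?k \<in> bcontfun\<close>] by metis
    have small: "norm (b * k) \<le> e / 2"
    proof (rule norm_bound)
      fix y
      show "norm (apply_bcontfun (b * k) y) \<le> e / 2"
      proof (cases "dist y x < d")
        case True
        have "norm (apply_bcontfun b y) * norm (apply_bcontfun k y) \<le> e / 2 * 1"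
          using close[OF True] \<open>e > 0\<close> by (intro mult_mono) (auto simp: b_apply dist_norm k)
        then show ?thesis by (simp add: norm_mult)
      next
        case False
        then have "2 / d * d \<le> 2 / d * dist y x"
          using d by (intro mult_left_mono) auto
        then have "2 - 2 / d * dist y x \<le> 0"
          using d by simp
        then show ?thesis using \<open>e > 0\<close> by (simp add: k)
      qed
    qed
    obtain n0 where n0: "2 / d < real n0"
      using reals_Archimedean2 by blast
    have "norm (blinfun_apply (\<pi> a) (\<xi> n) - apply_bcontfun a x *\<^sub>C \<xi> n - 0) < e" if "n \<ge> n0" for n
    proof -
      have "b * k * tent x (real (Suc n)) = b * tent x (real (Suc n))"
      proof (rule bcontfun_eqI)
        fix y
        have "apply_bcontfun k y = 1" if "apply_bcontfun (tent x (real (Suc n))) y \<noteq> 0"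
        proof -
          have "real (Suc n) * dist y x < 1"
            using that by (auto simp: tent.rep_eq max_def simp del: of_nat_Suc split: if_splits)
          moreover have "2 / d * dist y x \<le> real (Suc n) * dist y x"
            using n0 \<open>n \<ge> n0\<close> by (intro mult_right_mono) auto
          ultimately show ?thesis by (simp add: k)
        qed
        then show "apply_bcontfun (b * k * tent x (real (Suc n))) y
            = apply_bcontfun (b * tent x (real (Suc n))) y"
          by auto
      qed
      then have "blinfun_apply (\<pi> b) (\<xi> n) = blinfun_apply (\<pi> (b * k)) (\<xi> n)"
        unfolding \<xi>_def by (metis blinfun_apply_blinfun_compose rep_mult[OF \<pi>])
      moreover have "blinfun_apply (\<pi> b) (\<xi> n)
          = blinfun_apply (\<pi> a) (\<xi> n) - apply_bcontfun a x *\<^sub>C \<xi> n"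
        by (simp add: b_def rep_diff[OF \<pi>] rep_scaleC[OF \<pi>] rep_one[OF \<pi>] blinfun.diff_left
            scaleC_blinfun.rep_eq)
      moreover have "norm (blinfun_apply (\<pi> (b * k)) (\<xi> n)) \<le> e / 2 * 1"
        using norm_blinfun[of "\<pi> (b * k)" "\<xi> n"] small \<zeta>[of n]
          rep_bcontfun_contractive[OF \<pi>, of "b * k"]
        by (simp add: \<xi>_def)
      ultimately show ?thesis using \<open>e > 0\<close> by simp
    qed
    then show "\<exists>n0. \<forall>n\<ge>n0. norm (blinfun_apply (\<pi> a) (\<xi> n) - apply_bcontfun a x *\<^sub>C \<xi> n - 0) < e"
      by blast
  qed
  then have "approx_eigenvectors \<pi> x \<xi>"
    using \<zeta> by (auto simp: approx_eigenvectors_def \<xi>_def)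
  then show ?thesis by (intro exI[of _ \<xi>])
qed

section \<open>Slicing an operator at a point of the interval\<close>

text \<open>
  \<open>V\<close> is what remains of \<open>W\<close> on the second tensor factor when the first one is frozen along
  \<open>\<xi>\<close>.  For approximate eigenvectors at \<open>x\<close> this relation is, on the spatial
  tensor product, the graph of the *-homomorphism \<open>ev\<^sub>x \<otimes> id\<close>.
\<close>

definition slices_to :: "(nat \<Rightarrow> 'i ell2) \<Rightarrow> ('i \<times> 'j) op \<Rightarrow> 'j op \<Rightarrow> bool" where
  "slices_to \<xi> W V \<longleftrightarrow>
     (\<forall>\<eta>. (\<lambda>n. blinfun_apply W (\<xi> n \<otimes>\<^sub>2 \<eta>) - \<xi> n \<otimes>\<^sub>2 blinfun_apply V \<eta>) \<longlonglongrightarrow> 0)"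

lemma slices_to_zero: "slices_to \<xi> 0 0"
proof -
  have "x \<otimes>\<^sub>2 y = 0" if "y = 0" for x :: "'a ell2" and y :: "'b ell2"
    using norm_ell2_tensor[of x y] that by simp
  then show ?thesis by (simp add: slices_to_def)
qed

lemma slices_to_add:
  assumes "slices_to \<xi> W V" "slices_to \<xi> W' V'"
  shows "slices_to \<xi> (W + W') (V + V')"
  unfolding slices_to_def
proof
  fix \<eta>
  show "(\<lambda>n. blinfun_apply (W + W') (\<xi> n \<otimes>\<^sub>2 \<eta>) - \<xi> n \<otimes>\<^sub>2 blinfun_apply (V + V') \<eta>) \<longlonglongrightarrow> 0"
    using tendsto_add[OF assms[unfolded slices_to_def, rule_format, of \<eta>]]
    by (simp add: blinfun.add_left ell2_tensor_add_right algebra_simps)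
qed

lemma slices_to_scaleR:
  assumes "slices_to \<xi> W V"
  shows "slices_to \<xi> (r *\<^sub>R W) (r *\<^sub>R V)"
  unfolding slices_to_def
proof
  fix \<eta>
  show "(\<lambda>n. blinfun_apply (r *\<^sub>R W) (\<xi> n \<otimes>\<^sub>2 \<eta>) - \<xi> n \<otimes>\<^sub>2 blinfun_apply (r *\<^sub>R V) \<eta>) \<longlonglongrightarrow> 0"
    using tendsto_scaleR[OF tendsto_const[of r] assms[unfolded slices_to_def, rule_format, of \<eta>]]
    by (simp add: blinfun.scaleR_left ell2_tensor_scaleR_right scaleR_diff_right)
qed

lemma slices_to_diff:
  assumes "slices_to \<xi> W V" "slices_to \<xi> W' V'"
  shows "slices_to \<xi> (W - W') (V - V')"
  using slices_to_add[OF assms(1) slices_to_scaleR[OF assms(2), of "-1"]] by simp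

lemma slices_to_compose:
  assumes W: "slices_to \<xi> W V" and W': "slices_to \<xi> W' V'"
  shows "slices_to \<xi> (W o\<^sub>L W') (V o\<^sub>L V')"
  unfolding slices_to_def
proof
  fix \<eta>
  have "(\<lambda>n. blinfun_apply W (blinfun_apply W' (\<xi> n \<otimes>\<^sub>2 \<eta>) - \<xi> n \<otimes>\<^sub>2 blinfun_apply V' \<eta>))
      \<longlonglongrightarrow> blinfun_apply W 0"
    by (intro bounded_linear.tendsto[OF blinfun.bounded_linear_right])
       (use W' in \<open>simp add: slices_to_def\<close>)
  from tendsto_add[OF this W[unfolded slices_to_def, rule_format, of "blinfun_apply V' \<eta>"]]
  show "(\<lambda>n. blinfun_apply (W o\<^sub>L W') (\<xi> n \<otimes>\<^sub>2 \<eta>) - \<xi> n \<otimes>\<^sub>2 blinfun_apply (V o\<^sub>L V') \<eta>)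
      \<longlonglongrightarrow> 0"
    by (simp add: blinfun.diff_right)
qed

text \<open>
  For approximate eigenvectors at \<open>x\<close> this is the contractivity of \<open>ev\<^sub>x \<otimes> id\<close>.  It holds because
  \<open>\<xi> n \<otimes> V \<eta>\<close> has the norm of \<open>V \<eta>\<close>.
\<close>

lemma slices_to_norm:
  assumes W: "slices_to \<xi> W V" and \<xi>: "\<And>n. norm (\<xi> n) = 1"
  shows "norm V \<le> norm W"
proof (rule norm_blinfun_bound)
  fix \<eta>
  have "(\<lambda>n. norm (blinfun_apply W (\<xi> n \<otimes>\<^sub>2 \<eta>) - \<xi> n \<otimes>\<^sub>2 blinfun_apply V \<eta>) + norm W * norm \<eta>)
      \<longlonglongrightarrow> 0 + norm W * norm \<eta>"
    using W by (intro tendsto_intros tendsto_norm_zero) (simp add: slices_to_def)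
  moreover have "norm (blinfun_apply V \<eta>)
      \<le> norm (blinfun_apply W (\<xi> n \<otimes>\<^sub>2 \<eta>) - \<xi> n \<otimes>\<^sub>2 blinfun_apply V \<eta>) + norm W * norm \<eta>" for n
  proof -
    have "norm (\<xi> n \<otimes>\<^sub>2 blinfun_apply V \<eta>) \<le> norm (blinfun_apply W (\<xi> n \<otimes>\<^sub>2 \<eta>))
        + norm (blinfun_apply W (\<xi> n \<otimes>\<^sub>2 \<eta>) - \<xi> n \<otimes>\<^sub>2 blinfun_apply V \<eta>)"
      by (metis norm_triangle_sub norm_minus_commute)
    moreover have "norm (blinfun_apply W (\<xi> n \<otimes>\<^sub>2 \<eta>)) \<le> norm W * norm \<eta>"
      using norm_blinfun[of W "\<xi> n \<otimes>\<^sub>2 \<eta>"] by (simp add: norm_ell2_tensor \<xi>)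
    ultimately show ?thesis by (simp add: norm_ell2_tensor \<xi>)
  qed
  ultimately show "norm (blinfun_apply V \<eta>) \<le> norm W * norm \<eta>"
    by (intro LIMSEQ_le_const[where X = "\<lambda>n. norm (blinfun_apply W (\<xi> n \<otimes>\<^sub>2 \<eta>)
        - \<xi> n \<otimes>\<^sub>2 blinfun_apply V \<eta>) + norm W * norm \<eta>"]) auto
qed simp

lemma slices_to_op_tensor:
  fixes \<pi> :: "('x::metric_space \<Rightarrow>\<^sub>C complex) \<Rightarrow> 'i op"
  assumes \<pi>: "representation \<pi>" and T: "complex_linear T" and \<xi>: "approx_eigenvectors \<pi> x \<xi>"
  shows "slices_to \<xi> (op_tensor (\<pi> a) T) (apply_bcontfun a x *\<^sub>C T)"
  unfolding slices_to_def
proof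
  fix \<eta>
  have "(\<lambda>n. norm (blinfun_apply (\<pi> a) (\<xi> n) - apply_bcontfun a x *\<^sub>C \<xi> n) * norm (blinfun_apply T \<eta>))
      \<longlonglongrightarrow> 0 * norm (blinfun_apply T \<eta>)"
    using \<xi> by (intro tendsto_intros tendsto_norm_zero) (simp add: approx_eigenvectors_def)
  moreover have "blinfun_apply (op_tensor (\<pi> a) T) (\<xi> n \<otimes>\<^sub>2 \<eta>)
        - \<xi> n \<otimes>\<^sub>2 blinfun_apply (apply_bcontfun a x *\<^sub>C T) \<eta>
      = (blinfun_apply (\<pi> a) (\<xi> n) - apply_bcontfun a x *\<^sub>C \<xi> n) \<otimes>\<^sub>2 blinfun_apply T \<eta>" for n
    using op_tensor_apply[OF complex_linear_rep[OF \<pi>] T]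
    by (simp add: ell2_tensor_diff_left ell2_tensor_scaleC_left scaleC_blinfun.rep_eq)
  ultimately show "(\<lambda>n. blinfun_apply (op_tensor (\<pi> a) T) (\<xi> n \<otimes>\<^sub>2 \<eta>)
      - \<xi> n \<otimes>\<^sub>2 blinfun_apply (apply_bcontfun a x *\<^sub>C T) \<eta>) \<longlonglongrightarrow> 0"
    by (subst tendsto_norm_zero_iff[symmetric]) (simp add: norm_ell2_tensor)
qed

section \<open>Slice maps\<close>

lemma subspace_closure:
  fixes U :: "'v::real_normed_vector set"
  assumes "subspace U"
  shows "subspace (closure U)"
  unfolding subspace_def
proof (intro conjI ballI allI)
  show "0 \<in> closure U"
    using subspace_0[OF assms] closure_subset by blast
next
  fix x y assume "x \<in> closure U" "y \<in> closure U"
  then obtain f g where "\<And>n. f n \<in> U" "f \<longlonglongrightarrow> x" "\<And>n. g n \<in> U" "g \<longlonglongrightarrow> y"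
    unfolding closure_sequential by metis
  then show "x + y \<in> closure U"
    unfolding closure_sequential
    by (intro exI[of _ "\<lambda>n. f n + g n"]) (simp add: subspace_add[OF assms] tendsto_add)
next
  fix r x assume "x \<in> closure U"
  then obtain f where "\<And>n. f n \<in> U" "f \<longlonglongrightarrow> x"
    unfolding closure_sequential by metis
  then show "r *\<^sub>R x \<in> closure U"
    unfolding closure_sequential
    by (intro exI[of _ "\<lambda>n. r *\<^sub>R f n"]) (simp add: subspace_scale[OF assms] tendsto_scaleR)
qed

lemma spatial_tensor_subspace: "subspace (spatial_tensor \<pi> \<rho>)"
  unfolding spatial_tensor_def by (intro subspace_closure subspace_span)

lemma span_subset_spatial_tensor:
  "t \<in> span {op_tensor (\<pi> a) (\<rho> c) | a c. True} \<Longrightarrow> t \<in> spatial_tensor \<pi> \<rho>"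
  unfolding spatial_tensor_def using closure_subset by blast

lemma op_tensor_in_spatial_tensor: "op_tensor (\<pi> a) (\<rho> c) \<in> spatial_tensor \<pi> \<rho>"
  by (rule span_subset_spatial_tensor, rule span_base) blast

lemma slice_map_add:
  "slice_map \<pi> \<rho> \<nu> S \<Longrightarrow> s \<in> spatial_tensor \<pi> \<rho> \<Longrightarrow> t \<in> spatial_tensor \<pi> \<rho> \<Longrightarrow> S (s + t) = S s + S t"
  by (simp add: slice_map_def)

lemma slice_map_scaleR:
  assumes "slice_map \<pi> \<rho> \<nu> S" "t \<in> spatial_tensor \<pi> \<rho>"
  shows "S (r *\<^sub>R t) = r *\<^sub>R S t"
proof -
  have "S (complex_of_real r *\<^sub>C t) = complex_of_real r *\<^sub>C S t"
    using assms by (simp only: slice_map_def)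
  then show ?thesis by (simp add: scaleC_of_real)
qed

lemma slice_map_zero:
  assumes "slice_map \<pi> \<rho> \<nu> S"
  shows "S 0 = 0"
  using slice_map_scaleR[OF assms subspace_0[OF spatial_tensor_subspace], of 0] by simp

lemma slice_map_op_tensor:
  "slice_map \<pi> \<rho> \<nu> S \<Longrightarrow> S (op_tensor (\<pi> a) (\<rho> c)) = \<nu> c *\<^sub>C a"
  by (simp add: slice_map_def)

text \<open>
  Continuity at 0 and homogeneity give a bound \<open>M\<close>; the accuracy of the approximation of the
  projection below is chosen depending on it.
\<close>

lemma slice_map_bounded:
  assumes S: "slice_map \<pi> \<rho> \<nu> S"
  obtains M where "M > 0" "\<And>t. t \<in> spatial_tensor \<pi> \<rho> \<Longrightarrow> norm (S t) \<le> M * norm t"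
proof -
  let ?V = "spatial_tensor \<pi> \<rho>"
  have "continuous_on ?V S"
    using S by (simp add: slice_map_def)
  then obtain \<delta> where "\<delta> > 0" and \<delta>: "\<And>t. t \<in> ?V \<Longrightarrow> dist t 0 < \<delta> \<Longrightarrow> dist (S t) (S 0) < 1"
    using subspace_0[OF spatial_tensor_subspace] unfolding continuous_on_iff
    by (metis zero_less_one)
  have "norm (S t) \<le> 2 / \<delta> * norm t" if t: "t \<in> ?V" for t
  proof (cases "t = 0")
    case False
    define r where "r = \<delta> / (2 * norm t)"
    have "r > 0" using False \<open>\<delta> > 0\<close> by (simp add: r_def)
    have "dist (r *\<^sub>R t) 0 < \<delta>"
      using False \<open>\<delta> > 0\<close> by (simp add: r_def)
    then have "norm (S (r *\<^sub>R t)) < 1"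
      using \<delta>[OF subspace_scale[OF spatial_tensor_subspace t]] by (simp add: slice_map_zero[OF S])
    then have "r * norm (S t) < 1"
      using \<open>r > 0\<close> by (simp add: slice_map_scaleR[OF S t])
    then show ?thesis
      using False \<open>\<delta> > 0\<close> by (simp add: r_def field_simps)
  qed (simp add: slice_map_zero[OF S])
  then show thesis
    using \<open>\<delta> > 0\<close> by (intro that[of "2 / \<delta>"]) auto
qed

text \<open>
  The function \<open>g\<close> is \<open>x \<mapsto> \<Sum> a\<^sub>i(x) c\<^sub>i\<close> for \<open>t = \<Sum> a\<^sub>i \<otimes> c\<^sub>i\<close>.  Its values lie in the
  parameter-algebra, so the state \<open>\<nu>\<close> can be applied to them and the *-algebra structure of that
  algebra can be used.
\<close>

lemma algebraic_tensor_family: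
  fixes \<pi> :: "('x::metric_space \<Rightarrow>\<^sub>C complex) \<Rightarrow> 'i op" and \<rho> :: "'c::cstar_algebra \<Rightarrow> 'j op"
  assumes \<pi>: "representation \<pi>" and \<rho>: "representation \<rho>"
    and S: "slice_map \<pi> \<rho> \<nu> S" and \<nu>: "state \<nu>"
    and \<xi>: "\<And>x. approx_eigenvectors \<pi> x (\<xi> x)"
    and t: "t \<in> span {op_tensor (\<pi> a) (\<rho> c) | a c. True}"
  shows "\<exists>g. (\<forall>x. slices_to (\<xi> x) t (\<rho> (g x))) \<and> continuous_on UNIV (\<lambda>x. \<rho> (g x)) \<and>
    (\<forall>x. apply_bcontfun (S t) x = \<nu> (g x))"
proof -
  have \<nu>_add: "\<nu> (c + d) = \<nu> c + \<nu> d" and \<nu>_scaleC: "\<nu> (k *\<^sub>C c) = k * \<nu> c" for c d k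
    using \<nu> by (simp_all add: state_def)
  have \<nu>_0: "\<nu> 0 = 0"
    using \<nu>_add[of 0 0] by simp
  have \<nu>_scaleR: "\<nu> (r *\<^sub>R c) = of_real r * \<nu> c" for r c
    using \<nu>_scaleC[of "of_real r" c] by (simp add: scaleC_of_real)
  let ?fam = "\<lambda>t g. (\<forall>x. slices_to (\<xi> x) t (\<rho> (g x))) \<and> continuous_on UNIV (\<lambda>x. \<rho> (g x)) \<and>
    (\<forall>x. apply_bcontfun (S t) x = \<nu> (g x))"
  have "t \<in> spatial_tensor \<pi> \<rho> \<and> (\<exists>g. ?fam t g)"
    using t
  proof (induction rule: span_induct_alt)
    case base
    have "?fam 0 (\<lambda>_. 0)"
      by (auto simp: rep_zero[OF \<rho>] slices_to_zero slice_map_zero[OF S] \<nu>_0 zero_bcontfun.rep_eq)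
    then have "\<exists>g. ?fam 0 g"
      by (rule exI[of _ "\<lambda>_. 0"])
    then show ?case
      using subspace_0[OF spatial_tensor_subspace] by blast
  next
    case (step r b t)
    then obtain a c where b: "b = op_tensor (\<pi> a) (\<rho> c)" by blast
    from step obtain g where g: "?fam t g" and tV: "t \<in> spatial_tensor \<pi> \<rho>" by blast
    define g' where "g' x = r *\<^sub>R (apply_bcontfun a x *\<^sub>C c) + g x" for x
    have bV: "b \<in> spatial_tensor \<pi> \<rho>" unfolding b by (rule op_tensor_in_spatial_tensor)
    then have rbV: "r *\<^sub>R b \<in> spatial_tensor \<pi> \<rho>"
      by (rule subspace_scale[OF spatial_tensor_subspace])
    have \<rho>g': "\<rho> (g' x) = r *\<^sub>R (apply_bcontfun a x *\<^sub>C \<rho> c) + \<rho> (g x)" for x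
      by (simp add: g'_def rep_add[OF \<rho>] rep_scaleR[OF \<rho>] rep_scaleC[OF \<rho>])
    have "slices_to (\<xi> x) (r *\<^sub>R b + t) (\<rho> (g' x))" for x
      unfolding \<rho>g' b using g
      by (intro slices_to_add slices_to_scaleR slices_to_op_tensor \<pi> complex_linear_rep[OF \<rho>] \<xi>) blast
    moreover have "continuous_on UNIV (\<lambda>x. apply_bcontfun a x *\<^sub>C \<rho> c)"
    proof -
      have "bounded_linear (\<lambda>z. z *\<^sub>C \<rho> c)"
      proof (rule bounded_linear_intro[where K = "norm (\<rho> c)"])
        show "(s *\<^sub>R z) *\<^sub>C \<rho> c = s *\<^sub>R (z *\<^sub>C \<rho> c)" for s z
          by (simp add: scaleR_conv_of_real flip: scaleC_scaleC scaleC_of_real)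
      qed (simp_all add: scaleC_add_left norm_scaleC)
      then show ?thesis
        by (rule bounded_linear.continuous_on) (rule continuous_on_apply_bcontfun)
    qed
    then have "continuous_on UNIV (\<lambda>x. \<rho> (g' x))"
      unfolding \<rho>g' using g by (intro continuous_intros) auto
    moreover have "apply_bcontfun (S (r *\<^sub>R b + t)) x = \<nu> (g' x)" for x
    proof -
      have "S (r *\<^sub>R b + t) = r *\<^sub>R (\<nu> c *\<^sub>C a) + S t"
        unfolding slice_map_add[OF S rbV tV] slice_map_scaleR[OF S bV]
        by (simp add: b slice_map_op_tensor[OF S])
      moreover have "\<nu> (g' x) = of_real r * (apply_bcontfun a x * \<nu> c) + \<nu> (g x)"
        unfolding g'_def \<nu>_add \<nu>_scaleR \<nu>_scaleC ..
      ultimately show ?thesis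
        using g by (simp add: plus_bcontfun.rep_eq scaleR_bcontfun.rep_eq scaleC_complex_def
            scaleR_conv_of_real[where 'a = complex])
    qed
    ultimately have "?fam (r *\<^sub>R b + t) g'" by blast
    then have "\<exists>g. ?fam (r *\<^sub>R b + t) g"
      by (rule exI[of _ g'])
    then show ?case
      using subspace_add[OF spatial_tensor_subspace rbV tV] by blast
  qed
  then show ?thesis by blast
qed

section \<open>Classical parameter-algebras\<close>

lemma connected_unit_interval: "connected (UNIV :: unit_interval set)"
proof -
  have "continuous_on {0..1} unit_of_real"
    unfolding continuous_on_iff by (auto simp: dist_unit_interval_def unit_of_real_inverse)
  then have "connected (unit_of_real ` {0..1})"
    by (rule connected_continuous_image) simp
  then show ?thesis
    using type_definition.Abs_image[OF type_definition_unit_interval] by simp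
qed

lemma real_of_unit_bounds: "0 \<le> real_of_unit x" "real_of_unit x \<le> 1"
  using real_of_unit[of x] by auto

lemma real_of_unit_ends: "real_of_unit (unit_of_real 0) = 0" "real_of_unit (unit_of_real 1) = 1"
  by (simp_all add: unit_of_real_inverse)

text \<open>
  A projection in \<open>C[0,1] \<otimes> C\<close> with \<open>C\<close> commutative is a norm-continuous path of commuting
  projections, hence constant, and so is its image under the slice map.  Here the projection is
  replaced by an element \<open>t\<close> of the algebraic tensor product at distance \<open>\<epsilon>\<close>, whose slices \<open>g x\<close>
  are idempotent up to \<open>4\<epsilon>\<close>; \<open>\<epsilon> = r\<^sup>2\<close> is small compared with the reciprocal of the
  bound on the slice map.
\<close>

lemma slice_of_projection_not_coordinate:
  fixes \<pi> :: "(unit_interval \<Rightarrow>\<^sub>C complex) \<Rightarrow> 'i op" and \<rho> :: "'c::cstar_algebra \<Rightarrow> 'j op"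
  assumes \<pi>: "faithful_representation \<pi>" and \<rho>: "representation \<rho>"
    and comm: "\<And>c d :: 'c. c * d = d * c" and \<nu>: "state \<nu>" and S: "slice_map \<pi> \<rho> \<nu> S"
    and p: "p \<in> spatial_tensor \<pi> \<rho>" "p o\<^sub>L p = p" "norm p \<le> 1"
    and Sp: "\<And>x. apply_bcontfun (S p) x = of_real (real_of_unit x)"
  shows False
proof -
  have \<pi>': "representation \<pi>" using \<pi> by (simp add: faithful_representation_def)
  obtain M where "M > 0" and M: "\<And>t. t \<in> spatial_tensor \<pi> \<rho> \<Longrightarrow> norm (S t) \<le> M * norm t"
    using slice_map_bounded[OF S] by blast
  \<comment> \<open>At the end \<open>1 \<le> 24Mr + 2Mr\<^sup>2\<close> must be absurd, and \<open>288r\<^sup>2 < 1/4\<close> is needed for the gap.\<close>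
  define r where "r = 1 / (100 * (M + 1))"
  have r: "r > 0" "r \<le> 1 / 100" "M * r \<le> 1 / 100"
    using \<open>M > 0\<close> by (auto simp: r_def field_simps)
  have r2: "r\<^sup>2 \<le> (1 / 100)\<^sup>2"
    using r by (intro power_mono) auto
  obtain t where t: "t \<in> span {op_tensor (\<pi> a) (\<rho> c) | a c. True}" and "dist t p < r\<^sup>2"
    using p(1) r(1) unfolding spatial_tensor_def closure_approachable by (meson zero_less_power)
  then have near: "norm (t - p) \<le> r\<^sup>2" by (simp add: dist_norm)
  obtain \<xi> where \<xi>: "\<And>x. approx_eigenvectors \<pi> x (\<xi> x)"
    using approx_eigenvectors_exist[OF \<pi>] by metis
  then have norm_\<xi>: "norm (\<xi> x n) = 1" for x n
    by (simp add: approx_eigenvectors_def)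
  obtain g where slice: "\<And>x. slices_to (\<xi> x) t (\<rho> (g x))"
    and cont: "continuous_on UNIV (\<lambda>x. \<rho> (g x))"
    and St: "\<And>x. apply_bcontfun (S t) x = \<nu> (g x)"
    using algebraic_tensor_family[OF \<pi>' \<rho> S \<nu> \<xi> t] by blast
  have tV: "t \<in> spatial_tensor \<pi> \<rho>" by (rule span_subset_spatial_tensor[OF t])
  have norm_t: "norm t \<le> 2"
    using near p(3) r2 norm_triangle_sub[of t p] by (simp add: power2_eq_square)
  have norm_g: "norm (\<rho> (g x)) \<le> 2" for x
    using slices_to_norm[OF slice norm_\<xi>, of x] norm_t by linarith
  have idem: "norm (\<rho> (g x * g x - g x)) \<le> 4 * r\<^sup>2" for x
  proof -
    have "slices_to (\<xi> x) ((t o\<^sub>L t) - t) ((\<rho> (g x) o\<^sub>L \<rho> (g x)) - \<rho> (g x))"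
      by (intro slices_to_diff slices_to_compose slice)
    from slices_to_norm[OF this norm_\<xi>]
    have "norm (\<rho> (g x * g x - g x)) \<le> norm ((t o\<^sub>L t) - t)"
      by (simp add: rep_diff[OF \<rho>] rep_mult[OF \<rho>])
    also have "(t o\<^sub>L t) - t = ((t - p) o\<^sub>L t) + ((p o\<^sub>L (t - p)) - (t - p))"
    proof (rule blinfun_eqI)
      fix \<zeta>
      have "blinfun_apply p (blinfun_apply p \<zeta>) = blinfun_apply p \<zeta>"
        using p(2) by (metis blinfun_apply_blinfun_compose)
      then show "blinfun_apply ((t o\<^sub>L t) - t) \<zeta>
          = blinfun_apply (((t - p) o\<^sub>L t) + ((p o\<^sub>L (t - p)) - (t - p))) \<zeta>"
        by (simp add: blinfun.add_left blinfun.diff_left blinfun.diff_right)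
    qed
    also have "norm \<dots> \<le> norm ((t - p) o\<^sub>L t) + (norm (p o\<^sub>L (t - p)) + norm (t - p))"
      by (rule norm_triangle_le) (rule add_left_mono[OF norm_triangle_ineq4])
    also have "\<dots> \<le> r\<^sup>2 * 2 + (1 * r\<^sup>2 + r\<^sup>2)"
      using near norm_t p(3)
      by (intro add_mono order_trans[OF norm_blinfun_compose] mult_mono) auto
    finally show ?thesis by simp
  qed
  define x0 x1 where "x0 = unit_of_real 0" and "x1 = unit_of_real 1"
  define N where "N x = norm (\<rho> (g x - g x0))" for x
  have gap: "(N x)\<^sup>2 * (1 - (N x)\<^sup>2) \<le> 288 * r\<^sup>2" for x
    using almost_idempotent_gap[OF \<rho> comm idem[of x] norm_g[of x] idem[of x0] norm_g[of x0]]
    by (simp add: N_def)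
  have cont_N: "continuous_on UNIV (\<lambda>x. (N x)\<^sup>2)"
    unfolding N_def rep_diff[OF \<rho>] using cont by (intro continuous_intros)
  \<comment> \<open>The gap excludes the value 1/2, and \<open>N\<close> vanishes at \<open>x0\<close>.\<close>
  have "(N x)\<^sup>2 < 1 / 2" for x
  proof (rule ccontr)
    assume "\<not> (N x)\<^sup>2 < 1 / 2"
    then have upper: "1 / 2 \<le> (N x)\<^sup>2" by simp
    have lower: "(N x0)\<^sup>2 \<le> 1 / 2"
      by (simp add: N_def rep_zero[OF \<rho>])
    have conn: "connected (range (\<lambda>x. (N x)\<^sup>2))"
      by (rule connected_continuous_image[OF cont_N connected_unit_interval])
    have "1 / 2 \<in> range (\<lambda>x. (N x)\<^sup>2)"
      by (rule connectedD_interval[OF conn rangeI rangeI lower upper])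
    then obtain y where y: "(N y)\<^sup>2 = 1 / 2" by (auto elim: sym)
    have "1 / 2 * (1 - 1 / 2) \<le> 288 * r\<^sup>2"
      using gap[of y] unfolding y .
    then show False using r2 by (simp add: power2_eq_square)
  qed
  then have "(N x1)\<^sup>2 * (1 / 2) \<le> (N x1)\<^sup>2 * (1 - (N x1)\<^sup>2)"
    by (intro mult_left_mono) (auto simp: less_imp_le)
  then have "(N x1)\<^sup>2 \<le> (24 * r)\<^sup>2"
    using gap[of x1] by (simp add: power_mult_distrib)
  then have N1: "N x1 \<le> 24 * r"
    by (rule power2_le_imp_le) (use r in simp)
  have "cmod (\<nu> c) \<le> M * norm (\<rho> c)" for c
  proof -
    have "cmod (\<nu> c) = norm (S (op_tensor (\<pi> 1) (\<rho> c)))"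
      by (simp add: slice_map_op_tensor[OF S] norm_scaleC)
    also have "\<dots> \<le> M * norm (op_tensor (\<pi> 1) (\<rho> c))"
      by (rule M[OF op_tensor_in_spatial_tensor])
    also have "\<dots> \<le> M * (1 * norm (\<rho> c))"
    proof (intro mult_left_mono)
      have "norm (\<pi> 1) \<le> 1"
        by (simp add: rep_one[OF \<pi>'] norm_blinfun_id_le)
      then show "norm (op_tensor (\<pi> 1) (\<rho> c)) \<le> 1 * norm (\<rho> c)"
        by (intro order_trans[OF norm_op_tensor] complex_linear_rep[OF \<pi>'] complex_linear_rep[OF \<rho>]
            mult_right_mono) auto
    qed (use \<open>M > 0\<close> in simp)
    finally show ?thesis by simp
  qed
  then have "cmod (\<nu> (g x1 - g x0)) \<le> M * (24 * r)"
    using N1 \<open>M > 0\<close> unfolding N_def by (meson mult_left_mono less_imp_le order_trans)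
  moreover have "\<nu> (g x1 - g x0) = \<nu> (g x1) - \<nu> (g x0)"
  proof -
    have "\<nu> (g x1) = \<nu> ((g x1 - g x0) + g x0)" by simp
    also have "\<dots> = \<nu> (g x1 - g x0) + \<nu> (g x0)"
      using \<nu> unfolding state_def by blast
    finally show ?thesis by simp
  qed
  ultimately have close: "cmod (\<nu> (g x1) - \<nu> (g x0)) \<le> 24 * (M * r)"
    by (simp add: mult_ac)
  have near_x: "cmod (\<nu> (g x) - of_real (real_of_unit x)) \<le> M * r\<^sup>2" for x
  proof -
    have dV: "t - p \<in> spatial_tensor \<pi> \<rho>"
      by (rule subspace_diff[OF spatial_tensor_subspace tV p(1)])
    have "S t - S p = S (t - p)"
      using slice_map_add[OF S dV p(1)] by simp
    then have "cmod (\<nu> (g x) - of_real (real_of_unit x)) = cmod (apply_bcontfun (S (t - p)) x)"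
      by (metis St Sp minus_bcontfun.rep_eq)
    also have "\<dots> \<le> norm (S (t - p))" by (rule norm_bounded)
    also have "\<dots> \<le> M * norm (t - p)" by (rule M[OF dV])
    also have "\<dots> \<le> M * r\<^sup>2" using near \<open>M > 0\<close> by (intro mult_left_mono) auto
    finally show ?thesis .
  qed
  have "M * r\<^sup>2 \<le> 1 / 100 * (1 / 100)"
    using mult_mono[OF r(3) r(2)] r(1) by (simp add: power2_eq_square mult.assoc)
  moreover have "1 \<le> cmod (\<nu> (g x1) - \<nu> (g x0)) + cmod (\<nu> (g x0)) + cmod (\<nu> (g x1) - 1)"
    using norm_triangle_ineq4[of "\<nu> (g x1) - \<nu> (g x0) + \<nu> (g x0)" "\<nu> (g x1) - 1"]
      norm_triangle_ineq[of "\<nu> (g x1) - \<nu> (g x0)" "\<nu> (g x0)"] by simp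
  ultimately show False
    using close near_x[of x0] near_x[of x1] r(3)
    by (simp add: x0_def x1_def real_of_unit_ends)
qed

section \<open>Representations of functions and of matrices on square-summable families\<close>

definition mult_fun :: "('x::metric_space \<Rightarrow>\<^sub>C complex) \<Rightarrow> 'x ell2 \<Rightarrow> 'x ell2" where
  "mult_fun a \<xi> = Abs_ell2 (\<lambda>x. apply_bcontfun a x * ell2_nth \<xi> x)"

lemma mult_fun_bound: "(cmod (apply_bcontfun a x * z))\<^sup>2 \<le> (norm a)\<^sup>2 * (cmod z)\<^sup>2"
  unfolding norm_mult power_mult_distrib
  by (intro mult_right_mono power_mono norm_bounded) auto

lemma mult_fun_nth: "ell2_nth (mult_fun a \<xi>) x = apply_bcontfun a x * ell2_nth \<xi> x"
proof -
  have "(\<lambda>x. (cmod (apply_bcontfun a x * ell2_nth \<xi> x))\<^sup>2) summable_on UNIV"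
  proof (rule summable_on_comparison_test)
    show "(\<lambda>x. (norm a)\<^sup>2 * (cmod (ell2_nth \<xi> x))\<^sup>2) summable_on UNIV"
      by (intro summable_on_cmult_right ell2_summable)
  qed (use mult_fun_bound in auto)
  then show ?thesis
    unfolding mult_fun_def by (subst Abs_ell2_inverse) auto
qed

lemma norm_mult_fun: "norm (mult_fun a \<xi>) \<le> norm a * norm \<xi>"
proof -
  have "(norm (mult_fun a \<xi>))\<^sup>2 \<le> (norm a)\<^sup>2 * (norm \<xi>)\<^sup>2"
  proof (rule has_sum_mono)
    show "((\<lambda>x. (norm a)\<^sup>2 * (cmod (ell2_nth \<xi> x))\<^sup>2) has_sum (norm a)\<^sup>2 * (norm \<xi>)\<^sup>2) UNIV"
      by (rule has_sum_cmult_right[OF ell2_norm_has_sum])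
  qed (use ell2_norm_has_sum mult_fun_bound in \<open>auto simp: mult_fun_nth\<close>)
  then show ?thesis
    by (metis mult_nonneg_nonneg norm_ge_zero power2_le_imp_le power_mult_distrib)
qed

lift_definition mult_op :: "('x::metric_space \<Rightarrow>\<^sub>C complex) \<Rightarrow> 'x op" is mult_fun
proof (rule bounded_linear_intro)
  fix a :: "'x \<Rightarrow>\<^sub>C complex" and \<xi> \<eta> :: "'x ell2" and r :: real
  show "mult_fun a (\<xi> + \<eta>) = mult_fun a \<xi> + mult_fun a \<eta>"
    by (rule ell2_eqI) (simp add: mult_fun_nth plus_ell2.rep_eq distrib_left)
  show "mult_fun a (r *\<^sub>R \<xi>) = r *\<^sub>R mult_fun a \<xi>"
    by (rule ell2_eqI) (simp add: mult_fun_nth scaleR_ell2.rep_eq)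
  show "norm (mult_fun a \<xi>) \<le> norm \<xi> * norm a"
    using norm_mult_fun[of a \<xi>] by (simp add: mult.commute)
qed

lemma mult_op_nth: "ell2_nth (blinfun_apply (mult_op a) \<xi>) x = apply_bcontfun a x * ell2_nth \<xi> x"
  by (simp add: mult_op.rep_eq mult_fun_nth)

lemma faithful_mult_op: "faithful_representation (mult_op :: ('x::metric_space \<Rightarrow>\<^sub>C complex) \<Rightarrow> 'x op)"
  unfolding faithful_representation_def representation_def
proof (intro conjI allI)
  fix a b :: "'x \<Rightarrow>\<^sub>C complex" and c :: complex and \<xi> \<eta> :: "'x ell2"
  show "complex_linear (mult_op a)"
    unfolding complex_linear_def
    by (auto intro!: ell2_eqI simp: mult_op_nth scaleC_ell2.rep_eq)
  show "mult_op (a + b) = mult_op a + mult_op b"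
    by (auto intro!: blinfun_eqI ell2_eqI
        simp: mult_op_nth blinfun.add_left plus_ell2.rep_eq plus_bcontfun.rep_eq distrib_right)
  show "mult_op (c *\<^sub>C a) = c *\<^sub>C mult_op a"
    by (auto intro!: blinfun_eqI ell2_eqI
        simp: mult_op_nth scaleC_blinfun.rep_eq scaleC_ell2.rep_eq scaleC_complex_def)
  show "mult_op (a * b) = mult_op a o\<^sub>L mult_op b"
    by (auto intro!: blinfun_eqI ell2_eqI simp: mult_op_nth)
  show "mult_op (1 :: 'x \<Rightarrow>\<^sub>C complex) = id_blinfun"
    by (auto intro!: blinfun_eqI ell2_eqI simp: mult_op_nth)
  show "cinner (blinfun_apply (mult_op (star a)) \<xi>) \<eta> = cinner \<xi> (blinfun_apply (mult_op a) \<eta>)"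
    unfolding cinner.rep_eq
    by (rule infsum_cong) (simp add: mult_op_nth star_complex_def)
next
  show "inj (mult_op :: ('x \<Rightarrow>\<^sub>C complex) \<Rightarrow> 'x op)"
  proof (rule injI, rule bcontfun_eqI)
    fix a b :: "'x \<Rightarrow>\<^sub>C complex" and x
    assume "mult_op a = mult_op b"
    then have "ell2_nth (blinfun_apply (mult_op a) (basis_vec x)) x
        = ell2_nth (blinfun_apply (mult_op b) (basis_vec x)) x" by simp
    then show "apply_bcontfun a x = apply_bcontfun b x"
      by (simp add: mult_op_nth basis_vec.rep_eq)
  qed
qed

lift_definition mat_fun :: "'n::finite cmatrix \<Rightarrow> 'n ell2 \<Rightarrow> 'n ell2"
  is "\<lambda>A \<xi> i. \<Sum>j\<in>UNIV. A $ i $ j * \<xi> j"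
  by simp

lift_definition mat_op :: "'n::finite cmatrix \<Rightarrow> 'n op" is mat_fun
proof (rule bounded_linear_intro)
  fix A :: "'n cmatrix" and \<xi> \<eta> :: "'n ell2" and r :: real
  show "mat_fun A (\<xi> + \<eta>) = mat_fun A \<xi> + mat_fun A \<eta>"
    by (rule ell2_eqI) (simp add: mat_fun.rep_eq plus_ell2.rep_eq distrib_left sum.distrib)
  show "mat_fun A (r *\<^sub>R \<xi>) = r *\<^sub>R mat_fun A \<xi>"
    by (rule ell2_eqI) (simp add: mat_fun.rep_eq scaleR_ell2.rep_eq scaleR_sum_right)
  have "norm (mat_fun A \<xi>) = L2_set (\<lambda>i. cmod (ell2_nth (mat_fun A \<xi>) i)) UNIV"
  proof -
    have "((\<lambda>i. (cmod (ell2_nth (mat_fun A \<xi>) i))\<^sup>2) has_sum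
        (\<Sum>i\<in>UNIV. (cmod (ell2_nth (mat_fun A \<xi>) i))\<^sup>2)) UNIV"
      by (rule has_sum_finite) simp
    from has_sum_unique[OF this ell2_norm_has_sum] show ?thesis
      by (simp add: L2_set_def)
  qed
  also have "\<dots> \<le> (\<Sum>i\<in>UNIV. cmod (ell2_nth (mat_fun A \<xi>) i))"
    by (rule L2_set_le_sum) simp
  also have "\<dots> \<le> (\<Sum>i\<in>UNIV. \<Sum>j\<in>UNIV. norm \<xi> * cmod (mat_of A $ i $ j))"
    unfolding mat_fun.rep_eq
    by (intro sum_mono sum_norm_le)
       (simp add: norm_mult mult.commute[of "cmod (mat_of A $ _ $ _)"] mult_right_mono cmod_nth_le_norm)
  finally show "norm (mat_fun A \<xi>) \<le> norm \<xi> * (\<Sum>i\<in>UNIV. \<Sum>j\<in>UNIV. cmod (mat_of A $ i $ j))"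
    by (simp add: sum_distrib_left)
qed

lemma mat_op_nth:
  "ell2_nth (blinfun_apply (mat_op A) \<xi>) i = (\<Sum>j\<in>UNIV. mat_of A $ i $ j * ell2_nth \<xi> j)"
  by (simp add: mat_op.rep_eq mat_fun.rep_eq)

lemma faithful_mat_op: "faithful_representation (mat_op :: 'n::finite cmatrix \<Rightarrow> 'n op)"
  unfolding faithful_representation_def representation_def
proof (intro conjI allI)
  fix A B :: "'n cmatrix" and c :: complex and \<xi> \<eta> :: "'n ell2"
  show "complex_linear (mat_op A)"
    unfolding complex_linear_def
    by (auto intro!: ell2_eqI simp: mat_op_nth scaleC_ell2.rep_eq sum_distrib_left mult_ac)
  show "mat_op (A + B) = mat_op A + mat_op B"
    by (auto intro!: blinfun_eqI ell2_eqI
        simp: mat_op_nth blinfun.add_left plus_ell2.rep_eq plus_cmatrix.rep_eq distrib_right sum.distrib)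
  show "mat_op (c *\<^sub>C A) = c *\<^sub>C mat_op A"
    by (auto intro!: blinfun_eqI ell2_eqI
        simp: mat_op_nth scaleC_blinfun.rep_eq scaleC_ell2.rep_eq scaleC_cmatrix.rep_eq
          sum_distrib_left mult.assoc)
  show "mat_op (A * B) = mat_op A o\<^sub>L mat_op B"
  proof (intro blinfun_eqI ell2_eqI)
    fix \<xi> :: "'n ell2" and i
    have "(\<Sum>j\<in>UNIV. (\<Sum>k\<in>UNIV. mat_of A $ i $ k * mat_of B $ k $ j) * ell2_nth \<xi> j)
        = (\<Sum>k\<in>UNIV. mat_of A $ i $ k * (\<Sum>j\<in>UNIV. mat_of B $ k $ j * ell2_nth \<xi> j))"
      unfolding sum_distrib_left sum_distrib_right
      by (subst sum.swap) (simp add: mult.assoc)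
    then show "ell2_nth (blinfun_apply (mat_op (A * B)) \<xi>) i
        = ell2_nth (blinfun_apply (mat_op A o\<^sub>L mat_op B) \<xi>) i"
      by (simp add: mat_op_nth times_cmatrix.rep_eq matrix_matrix_mult_def)
  qed
  show "mat_op (1 :: 'n cmatrix) = id_blinfun"
  proof (intro blinfun_eqI ell2_eqI)
    fix \<xi> :: "'n ell2" and i
    have "(if i = j then 1 else 0) * ell2_nth \<xi> j = (if i = j then ell2_nth \<xi> j else 0)" for j
      by simp
    then show "ell2_nth (blinfun_apply (mat_op 1) \<xi>) i = ell2_nth (blinfun_apply id_blinfun \<xi>) i"
      by (simp add: mat_op_nth one_cmatrix.rep_eq mat_def)
  qed
  show "cinner (blinfun_apply (mat_op (star A)) \<xi>) \<eta> = cinner \<xi> (blinfun_apply (mat_op A) \<eta>)"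
    unfolding cinner.rep_eq mat_op_nth star_cmatrix.rep_eq
    by (simp add: sum_distrib_left sum_distrib_right, subst sum.swap) (simp add: mult_ac)
next
  show "inj (mat_op :: 'n cmatrix \<Rightarrow> 'n op)"
  proof (rule injI)
    fix A B :: "'n cmatrix"
    assume eq: "mat_op A = mat_op B"
    have entry: "ell2_nth (blinfun_apply (mat_op A) (basis_vec j)) i = mat_of A $ i $ j"
      for A :: "'n cmatrix" and i j
    proof -
      have "mat_of A $ i $ k * (if k = j then 1 else 0) = (if k = j then mat_of A $ i $ j else 0)" for k
        by simp
      then show ?thesis by (simp add: mat_op_nth basis_vec.rep_eq)
    qed
    show "A = B"
      using entry[of A] entry[of B] eq by (simp add: vec_eq_iff flip: mat_of_inject)
  qed
qed

lemma rep_mult_op: "representation (mult_op :: ('x::metric_space \<Rightarrow>\<^sub>C complex) \<Rightarrow> 'x op)"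
  and rep_mat_op: "representation (mat_op :: 'n::finite cmatrix \<Rightarrow> 'n op)"
  using faithful_mult_op faithful_mat_op by (auto simp: faithful_representation_def)

lemma op_tensor_mult_mat_nth:
  "ell2_nth (blinfun_apply (op_tensor (mult_op a) (mat_op A)) \<zeta>) (x, i)
     = apply_bcontfun a x * (\<Sum>j\<in>UNIV. mat_of A $ i $ j * ell2_nth \<zeta> (x, j))"
  by (simp add: op_tensor_eq complex_linear_rep[OF rep_mult_op] complex_linear_rep[OF rep_mat_op]
      tensor_witness_nth mult_op_nth row.rep_eq ell2_flip.rep_eq amplify_fun_nth mat_op_nth)

lemma scaleC_op_tensor_mult_mat:
  "c *\<^sub>C op_tensor (mult_op a) (mat_op A) = op_tensor (mult_op (c *\<^sub>C a)) (mat_op A)"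
  by (auto intro!: blinfun_eqI ell2_pair_eqI
      simp: scaleC_blinfun.rep_eq scaleC_ell2.rep_eq op_tensor_mult_mat_nth scaleC_complex_def)

lemma op_tensor_mult_mat_one: "op_tensor (mult_op 1) (mat_op 1) = id_blinfun"
proof (intro blinfun_eqI ell2_pair_eqI)
  fix \<zeta> :: "('x::metric_space \<times> 'n::finite) ell2" and x i
  have "(if i = j then 1 else 0) * ell2_nth \<zeta> (x, j) = (if i = j then ell2_nth \<zeta> (x, j) else 0)" for j
    by simp
  then show "ell2_nth (blinfun_apply (op_tensor (mult_op 1) (mat_op 1)) \<zeta>) (x, i)
      = ell2_nth (blinfun_apply id_blinfun \<zeta>) (x, i)"
    by (simp add: op_tensor_mult_mat_nth one_cmatrix.rep_eq mat_def)
qed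

section \<open>Representations of the two-point algebra\<close>

lemma cinner_scaleC_left: "cinner (c *\<^sub>C x) y = cnj c * cinner x y"
  unfolding cinner.rep_eq scaleC_ell2.rep_eq by (simp add: mult.assoc infsum_cmult_right')

lemma cinner_scaleC_right: "cinner x (c *\<^sub>C y) = c * cinner x y"
  by (subst (1 2) cinner_commute) (simp add: cinner_scaleC_left)

lemma cinner_add_right: "cinner x (y + z) = cinner x y + cinner x z"
  by (subst (1 2 3) cinner_commute) (simp add: cinner_add_left)

lemma cinner_diff_left: "cinner (x - y) z = cinner x z - cinner y z"
  using cinner_add_left[of "x - y" y z] by (simp add: algebra_simps)

lemma cinner_diff_right: "cinner x (y - z) = cinner x y - cinner x z"
  using cinner_add_right[of x "y - z" z] by (simp add: algebra_simps)

lemma scaleC_diff_right: "c *\<^sub>C (x - y) = c *\<^sub>C x - c *\<^sub>C y" for x y :: "'a::complex_normed_vector"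
  using scaleC_add_right[of c "x - y" y] by (simp add: algebra_simps)

lemma scaleC_one: "1 *\<^sub>C x = x" for x :: "'a::complex_normed_vector"
  using scaleC_of_real[of 1 x] by simp

text \<open>
  The functions on two points are spanned by two complementary idempotents, so a morphism
  out of this algebra is the same as a projection.
\<close>

definition projection_rep :: "'i op \<Rightarrow> (bit \<Rightarrow>\<^sub>C complex) \<Rightarrow> 'i op" where
  "projection_rep p f = apply_bcontfun f 0 *\<^sub>C p + apply_bcontfun f 1 *\<^sub>C (id_blinfun - p)"

lemma representation_projection_rep:
  assumes lin: "complex_linear p" and idem: "p o\<^sub>L p = p"
    and adj: "\<And>\<xi> \<eta>. cinner (blinfun_apply p \<xi>) \<eta> = cinner \<xi> (blinfun_apply p \<eta>)"
  shows "representation (projection_rep p)"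
  unfolding representation_def
proof (intro conjI allI)
  fix f g :: "bit \<Rightarrow>\<^sub>C complex" and c :: complex and \<xi> \<eta> :: "'a ell2"
  have rep_apply: "blinfun_apply (projection_rep p f) \<xi> = apply_bcontfun f 0 *\<^sub>C blinfun_apply p \<xi>
      + apply_bcontfun f 1 *\<^sub>C (\<xi> - blinfun_apply p \<xi>)" for f \<xi>
    by (simp add: projection_rep_def blinfun.add_left blinfun.diff_left scaleC_blinfun.rep_eq)
  have p_scaleC: "blinfun_apply p (k *\<^sub>C \<xi>) = k *\<^sub>C blinfun_apply p \<xi>" for k \<xi>
    using lin by (simp add: complex_linear_def)
  have p_p: "blinfun_apply p (blinfun_apply p \<xi>) = blinfun_apply p \<xi>" for \<xi>
    using idem by (metis blinfun_apply_blinfun_compose)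
  show "complex_linear (projection_rep p f)"
    unfolding complex_linear_def rep_apply p_scaleC
    by (simp add: scaleC_scaleC scaleC_add_right scaleC_diff_right mult.commute)
  show "projection_rep p (f + g) = projection_rep p f + projection_rep p g"
    by (simp add: projection_rep_def plus_bcontfun.rep_eq scaleC_add_left)
  show "projection_rep p (c *\<^sub>C f) = c *\<^sub>C projection_rep p f"
    by (simp add: projection_rep_def scaleC_complex_def scaleC_add_right scaleC_scaleC)
  show "projection_rep p (f * g) = projection_rep p f o\<^sub>L projection_rep p g"
  proof (rule blinfun_eqI)
    fix \<xi>
    have zero: "k *\<^sub>C (0 :: 'a ell2) = 0" for k
      using scaleC_diff_right[of k 0 "0 :: 'a ell2"] by simp
    show "blinfun_apply (projection_rep p (f * g)) \<xi>
        = blinfun_apply (projection_rep p f o\<^sub>L projection_rep p g) \<xi>"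
      by (simp add: rep_apply blinfun.add_right blinfun.diff_right p_scaleC p_p zero scaleC_scaleC)
  qed
  show "projection_rep p 1 = id_blinfun"
    by (simp add: projection_rep_def scaleC_one)
  show "cinner (blinfun_apply (projection_rep p (star f)) \<xi>) \<eta>
      = cinner \<xi> (blinfun_apply (projection_rep p f) \<eta>)"
    by (simp add: rep_apply cinner_add_left cinner_add_right cinner_diff_left cinner_diff_right
        cinner_scaleC_left cinner_scaleC_right star_complex_def adj)
qed

section \<open>A quantum implementation with \<open>2 \<times> 2\<close> matrices\<close>

lemma continuous_on_real_of_unit: "continuous_on A real_of_unit"
  unfolding continuous_on_iff by (auto simp: dist_unit_interval_def)

lift_definition coordinate :: "unit_interval \<Rightarrow>\<^sub>C complex" is "\<lambda>x. complex_of_real (real_of_unit x)"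
  by (rule bcontfun_normI[where b = 1])
     (use real_of_unit_bounds in \<open>auto intro!: continuous_intros continuous_on_real_of_unit\<close>)

lift_definition off_diagonal :: "unit_interval \<Rightarrow>\<^sub>C complex"
  is "\<lambda>x. complex_of_real (sqrt (real_of_unit x * (1 - real_of_unit x)))"
proof (rule bcontfun_normI[where b = 1])
  fix x
  have "real_of_unit x * (1 - real_of_unit x) \<le> 1 * 1"
    using real_of_unit_bounds[of x] by (intro mult_mono) auto
  then show "norm (complex_of_real (sqrt (real_of_unit x * (1 - real_of_unit x)))) \<le> 1"
    using real_of_unit_bounds[of x] by simp
qed (intro continuous_intros continuous_on_real_of_unit)

lift_definition mat_11 :: "2 cmatrix" is "\<chi> i j. if i = 1 \<and> j = 1 then 1 else 0" .
lift_definition mat_22 :: "2 cmatrix" is "\<chi> i j. if i = 2 \<and> j = 2 then 1 else 0" .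
lift_definition mat_swap :: "2 cmatrix" is "\<chi> i j. if i = j then 0 else 1" .

text \<open>
  The rank-one projection onto the line spanned by \<open>(\<surd>x, \<surd>(1 - x))\<close>, as a continuous function
  of \<open>x\<close> with values in the matrices; its upper left entry is \<open>x\<close>.
\<close>

definition path_projection :: "(unit_interval \<times> 2) op" where
  "path_projection = op_tensor (mult_op coordinate) (mat_op mat_11)
     + op_tensor (mult_op off_diagonal) (mat_op mat_swap)
     + op_tensor (mult_op (1 - coordinate)) (mat_op mat_22)"

lemma path_projection_nth:
  "ell2_nth (blinfun_apply path_projection \<zeta>) (x, 1) =
     real_of_unit x * ell2_nth \<zeta> (x, 1)
     + sqrt (real_of_unit x * (1 - real_of_unit x)) * ell2_nth \<zeta> (x, 2)"
  "ell2_nth (blinfun_apply path_projection \<zeta>) (x, 2) =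
     sqrt (real_of_unit x * (1 - real_of_unit x)) * ell2_nth \<zeta> (x, 1)
     + (1 - real_of_unit x) * ell2_nth \<zeta> (x, 2)"
  by (simp_all add: path_projection_def blinfun.add_left plus_ell2.rep_eq op_tensor_mult_mat_nth sum_2
      mat_11.rep_eq mat_22.rep_eq mat_swap.rep_eq coordinate.rep_eq off_diagonal.rep_eq
      minus_bcontfun.rep_eq)

lemma ell2_two_eqI:
  fixes \<zeta> \<omega> :: "('x \<times> 2) ell2"
  assumes "\<And>x. ell2_nth \<zeta> (x, 1) = ell2_nth \<omega> (x, 1)" "\<And>x. ell2_nth \<zeta> (x, 2) = ell2_nth \<omega> (x, 2)"
  shows "\<zeta> = \<omega>"
proof (rule ell2_pair_eqI)
  show "ell2_nth \<zeta> (x, i) = ell2_nth \<omega> (x, i)" for x and i :: 2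
    using assms exhaust_2[of i] by auto
qed

lemma path_projection_idem: "path_projection o\<^sub>L path_projection = path_projection"
proof (intro blinfun_eqI ell2_two_eqI)
  fix \<zeta> :: "(unit_interval \<times> 2) ell2" and x
  define t s where "t = complex_of_real (real_of_unit x)"
    and "s = complex_of_real (sqrt (real_of_unit x * (1 - real_of_unit x)))"
  have root: "sqrt (real_of_unit x * (1 - real_of_unit x)) * sqrt (real_of_unit x * (1 - real_of_unit x))
      = real_of_unit x * (1 - real_of_unit x)"
    using real_of_unit_bounds[of x] by simp
  have ss: "s * s = t * (1 - t)"
    unfolding s_def of_real_mult[symmetric] root by (simp add: t_def)
  have "t * (t * a + s * b) + s * (s * a + (1 - t) * b) = t * a + s * b"
    "s * (t * a + s * b) + (1 - t) * (s * a + (1 - t) * b) = s * a + (1 - t) * b" for a b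
    using ss by algebra+
  then show "ell2_nth (blinfun_apply (path_projection o\<^sub>L path_projection) \<zeta>) (x, 1)
      = ell2_nth (blinfun_apply path_projection \<zeta>) (x, 1)"
    "ell2_nth (blinfun_apply (path_projection o\<^sub>L path_projection) \<zeta>) (x, 2)
      = ell2_nth (blinfun_apply path_projection \<zeta>) (x, 2)"
    by (simp_all add: path_projection_nth flip: t_def s_def)
qed

lemma cinner_two:
  fixes \<zeta> \<omega> :: "('x \<times> 2) ell2"
  shows "cinner \<zeta> \<omega> = (\<Sum>\<^sub>\<infinity>x. cnj (ell2_nth \<zeta> (x, 1)) * ell2_nth \<omega> (x, 1)
    + cnj (ell2_nth \<zeta> (x, 2)) * ell2_nth \<omega> (x, 2))"
proof -
  have "((\<lambda>p. cnj (ell2_nth \<zeta> p) * ell2_nth \<omega> p) has_sum cinner \<zeta> \<omega>) (UNIV \<times> UNIV)"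
    unfolding cinner.rep_eq UNIV_Times_UNIV by (rule has_sum_infsum[OF cinner_summable])
  moreover have "((\<lambda>i. cnj (ell2_nth \<zeta> (x, i)) * ell2_nth \<omega> (x, i)) has_sum
      (cnj (ell2_nth \<zeta> (x, 1)) * ell2_nth \<omega> (x, 1)
       + cnj (ell2_nth \<zeta> (x, 2)) * ell2_nth \<omega> (x, 2))) UNIV" for x
    by (rule has_sum_finiteI) (simp_all add: sum_2)
  ultimately have "((\<lambda>x. cnj (ell2_nth \<zeta> (x, 1)) * ell2_nth \<omega> (x, 1)
    + cnj (ell2_nth \<zeta> (x, 2)) * ell2_nth \<omega> (x, 2)) has_sum cinner \<zeta> \<omega>) UNIV"
    by (rule has_sum_SigmaD)
  then show ?thesis by (simp add: infsumI)
qed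

lemma path_projection_adjoint:
  "cinner (blinfun_apply path_projection \<zeta>) \<omega> = cinner \<zeta> (blinfun_apply path_projection \<omega>)"
  unfolding cinner_two path_projection_nth
  by (rule infsum_cong) (simp add: algebra_simps)

lemma complex_linear_add: "complex_linear S \<Longrightarrow> complex_linear T \<Longrightarrow> complex_linear (S + T)"
  by (simp add: complex_linear_def blinfun.add_left scaleC_add_right)

lemma representation_path: "representation (projection_rep path_projection)"
proof (rule representation_projection_rep)
  show "complex_linear path_projection"
    unfolding path_projection_def
    by (intro complex_linear_add complex_linear_op_tensor complex_linear_rep rep_mult_op rep_mat_op)
qed (simp_all add: path_projection_idem path_projection_adjoint)

lemma range_path: "range (projection_rep path_projection) \<subseteq> spatial_tensor mult_op mat_op"
proof -
  let ?V = "spatial_tensor mult_op mat_op :: (unit_interval \<times> 2) op set"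
  have add: "S + T \<in> ?V" if "S \<in> ?V" "T \<in> ?V" for S T
    by (rule subspace_add[OF spatial_tensor_subspace that])
  have diff: "S - T \<in> ?V" if "S \<in> ?V" "T \<in> ?V" for S T
    by (rule subspace_diff[OF spatial_tensor_subspace that])
  have p: "c *\<^sub>C path_projection \<in> ?V" for c
    unfolding path_projection_def scaleC_add_right scaleC_op_tensor_mult_mat
    by (intro add op_tensor_in_spatial_tensor)
  have one: "c *\<^sub>C id_blinfun \<in> ?V" for c
    unfolding op_tensor_mult_mat_one[symmetric] scaleC_op_tensor_mult_mat
    by (rule op_tensor_in_spatial_tensor)
  show ?thesis
    unfolding projection_rep_def scaleC_diff_right by (auto intro!: add diff p one)
qed

lemma state_corner: "state (\<lambda>A :: 2 cmatrix. mat_of A $ 1 $ 1)"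
  unfolding state_def
proof (intro conjI allI)
  fix A :: "2 cmatrix"
  have "mat_of (star A * A) $ 1 $ 1
      = complex_of_real ((cmod (mat_of A $ 1 $ 1))\<^sup>2 + (cmod (mat_of A $ 2 $ 1))\<^sup>2)"
    unfolding of_real_add complex_norm_square
    by (simp add: times_cmatrix.rep_eq star_cmatrix.rep_eq matrix_matrix_mult_def sum_2 mult.commute)
  then show "mat_of (star A * A) $ 1 $ 1 \<in> \<real>\<^sub>\<ge>\<^sub>0"
    by (simp only: nonneg_Reals_of_real_iff) simp
qed (simp_all add: plus_cmatrix.rep_eq scaleC_cmatrix.rep_eq one_cmatrix.rep_eq mat_def)

text \<open>
  The slice along the state \<open>A \<mapsto> A\<^sub>1\<^sub>1\<close> reads off diagonal matrix coefficients, so it is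
  defined, contractive and linear on all operators for which these depend continuously on \<open>x\<close>;
  such operators form a closed subspace.
\<close>

definition corner :: "('x \<times> 2) op \<Rightarrow> 'x \<Rightarrow> complex" where
  "corner W x = ell2_nth (blinfun_apply W (basis_vec (x, 1))) (x, 1)"

lemma corner_add: "corner (S + T) x = corner S x + corner T x"
  and corner_diff: "corner (S - T) x = corner S x - corner T x"
  and corner_scaleR: "corner (r *\<^sub>R S) x = r *\<^sub>R corner S x"
  and corner_scaleC: "corner (c *\<^sub>C S) x = c * corner S x"
  by (simp_all add: corner_def blinfun.add_left blinfun.diff_left blinfun.scaleR_left
      scaleC_blinfun.rep_eq plus_ell2.rep_eq minus_ell2_nth scaleR_ell2.rep_eq scaleC_ell2.rep_eq)

lemma cmod_corner_le: "cmod (corner W x) \<le> norm W"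
  unfolding corner_def
  using order_trans[OF cmod_nth_le_norm norm_blinfun[of W "basis_vec (x, 1)"]] by simp

lemma corner_op_tensor:
  "corner (op_tensor (mult_op a) (mat_op A)) x = mat_of A $ 1 $ 1 * apply_bcontfun a x"
  by (simp add: corner_def op_tensor_mult_mat_nth sum_2 basis_vec.rep_eq)

lemma corner_continuous:
  fixes W :: "('x::metric_space \<times> 2) op"
  assumes "W \<in> spatial_tensor mult_op mat_op"
  shows "continuous_on UNIV (corner W)"
proof -
  let ?B = "{W :: ('x \<times> 2) op. continuous_on UNIV (corner W)}"
  have "subspace ?B"
    unfolding subspace_def
    by (auto simp: corner_add[abs_def] corner_scaleR[abs_def] corner_scaleR[of 0 0, simplified, abs_def]
        intro!: continuous_intros)
  then have "span {op_tensor (mult_op a) (mat_op A) | a A. True} \<subseteq> ?B"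
    by (intro span_minimal)
       (auto simp: corner_op_tensor[abs_def] intro!: continuous_intros continuous_on_apply_bcontfun)
  moreover have "closed ?B"
    unfolding closed_sequential_limits
  proof (intro allI impI, elim conjE, intro CollectI)
    fix X :: "nat \<Rightarrow> ('x \<times> 2) op" and L
    assume X: "\<forall>n. X n \<in> ?B" and lim: "X \<longlonglongrightarrow> L"
    have "uniform_limit UNIV (\<lambda>n. corner (X n)) (corner L) sequentially"
    proof (rule uniform_limitI)
      fix e :: real
      assume "e > 0"
      then have "\<forall>\<^sub>F n in sequentially. dist (X n) L < e"
        using lim by (simp add: tendsto_iff)
      then show "\<forall>\<^sub>F n in sequentially. \<forall>x\<in>UNIV. dist (corner (X n) x) (corner L x) < e"
      proof eventually_elim
        case (elim n)
        have "dist (corner (X n) x) (corner L x) \<le> dist (X n) L" for x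
          using cmod_corner_le[of "X n - L" x] by (simp add: dist_norm corner_diff)
        with elim show ?case using order_le_less_trans by blast
      qed
    qed
    then show "continuous_on UNIV (corner L)"
      using X by (intro uniform_limit_theorem[OF always_eventually _ trivial_limit_sequentially]) auto
  qed
  ultimately have "spatial_tensor mult_op mat_op \<subseteq> ?B"
    unfolding spatial_tensor_def by (rule closure_minimal)
  with assms show ?thesis by blast
qed

lemma Bcontfun_corner:
  fixes W :: "('x::metric_space \<times> 2) op"
  assumes "W \<in> spatial_tensor mult_op mat_op"
  shows "apply_bcontfun (Bcontfun (corner W)) x = corner W x"
  by (subst Bcontfun_inverse)
     (auto intro: bcontfun_normI corner_continuous[OF assms] cmod_corner_le)

lemma slice_map_corner:
  "slice_map (mult_op :: ('x::metric_space \<Rightarrow>\<^sub>C complex) \<Rightarrow> 'x op) mat_op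
     (\<lambda>A :: 2 cmatrix. mat_of A $ 1 $ 1) (\<lambda>W. Bcontfun (corner W))"
proof -
  let ?V = "spatial_tensor mult_op mat_op :: ('x \<times> 2) op set"
  have "dist (Bcontfun (corner S)) (Bcontfun (corner T)) \<le> dist S T" if "S \<in> ?V" "T \<in> ?V" for S T
    unfolding dist_norm
    by (rule norm_bound)
       (use cmod_corner_le[of "S - T"] in
         \<open>simp add: minus_bcontfun.rep_eq Bcontfun_corner[OF that(1)] Bcontfun_corner[OF that(2)]
           corner_diff\<close>)
  then have "continuous_on ?V (\<lambda>W. Bcontfun (corner W))"
    unfolding continuous_on_iff by (meson order_le_less_trans)
  moreover have "Bcontfun (corner (S + T)) = Bcontfun (corner S) + Bcontfun (corner T)"
    if "S \<in> ?V" "T \<in> ?V" for S T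
    using that subspace_add[OF spatial_tensor_subspace that]
    by (intro bcontfun_eqI) (simp add: Bcontfun_corner plus_bcontfun.rep_eq corner_add)
  moreover have "Bcontfun (corner (k *\<^sub>C T)) = k *\<^sub>C Bcontfun (corner T)" if "T \<in> ?V" for k T
  proof -
    have "corner (k *\<^sub>C T) = apply_bcontfun (k *\<^sub>C Bcontfun (corner T))"
      by (rule ext) (simp add: Bcontfun_corner[OF that] corner_scaleC scaleC_complex_def)
    then show ?thesis by (simp add: apply_bcontfun_inverse)
  qed
  moreover have "Bcontfun (corner (op_tensor (mult_op a) (mat_op A))) = mat_of A $ 1 $ 1 *\<^sub>C a"
    for a :: "'x \<Rightarrow>\<^sub>C complex" and A
    by (intro bcontfun_eqI)
       (simp add: Bcontfun_corner op_tensor_in_spatial_tensor corner_op_tensor scaleC_complex_def)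
  ultimately show ?thesis
    unfolding slice_map_def by blast
qed

lemma corner_path:
  "corner (projection_rep path_projection f) x =
     apply_bcontfun f 0 * of_real (real_of_unit x) + apply_bcontfun f 1 * of_real (1 - real_of_unit x)"
proof -
  have "corner path_projection x = of_real (real_of_unit x)"
    by (simp add: corner_def path_projection_nth basis_vec.rep_eq)
  moreover have "corner id_blinfun x = 1" for x :: unit_interval
    by (simp add: corner_def basis_vec.rep_eq)
  ultimately show ?thesis
    by (simp add: projection_rep_def corner_add corner_scaleC corner_diff)
qed

section \<open>The kernel and its implementations\<close>

lemma sets_borel_bit: "A \<in> sets borel" for A :: "bit set"
  by (rule borel_open[OF Topological_Spaces.open_discrete])

lemma integral_bit:
  fixes f :: "bit \<Rightarrow> complex"
  assumes "\<mu> \<in> prob_measures"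
  shows "(\<integral>y. f y \<partial>\<mu>) = f 0 * of_real (measure \<mu> {0}) + f 1 * of_real (measure \<mu> {1})"
proof -
  interpret prob_space \<mu>
    using assms by (simp add: prob_measures_def)
  have sets: "A \<in> sets \<mu>" for A
    using assms sets_borel_bit by (simp add: prob_measures_def)
  have space: "space \<mu> = UNIV"
    using assms sets_eq_imp_space_eq[of \<mu> borel] by (simp add: prob_measures_def)
  have int: "integrable \<mu> (\<lambda>y. indicator {b} y *\<^sub>R f b)" for b
    by (intro integrable_scaleR_left integrable_real_indicator sets)
      (simp add: emeasure_eq_measure)
  have "f = (\<lambda>y. indicator {0} y *\<^sub>R f 0 + indicator {1} y *\<^sub>R f 1)"
  proof
    show "f y = indicator {0} y *\<^sub>R f 0 + indicator {1} y *\<^sub>R f 1" for y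
      by (cases y) auto
  qed
  then have "(\<integral>y. f y \<partial>\<mu>) = (\<integral>y. indicator {0} y *\<^sub>R f 0 + indicator {1} y *\<^sub>R f 1 \<partial>\<mu>)"
    by simp
  also have "\<dots> = (\<integral>y. indicator {0} y *\<^sub>R f 0 \<partial>\<mu>) + (\<integral>y. indicator {1} y *\<^sub>R f 1 \<partial>\<mu>)"
    by (rule Bochner_Integration.integral_add[OF int int])
  also have "\<dots> = measure \<mu> {0} *\<^sub>R f 0 + measure \<mu> {1} *\<^sub>R f 1"
    by (simp add: sets space emeasure_eq_measure)
  finally show ?thesis by (simp add: scaleR_conv_of_real mult.commute)
qed

text \<open>
  For fixed \<open>z\<close> the map \<open>x \<mapsto> \<phi>(x, z)\<close> goes from a connected to a discrete space, so the
  events \<open>\<phi>(x, z) \<in> E\<close> do not depend on \<open>x\<close>.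
\<close>

lemma random_continuous_map_implements_constant:
  fixes \<phi> :: "unit_interval \<times> 'z::t2_space \<Rightarrow> bit"
  assumes \<phi>: "random_continuous_map \<phi> \<nu>" and K: "implements_kernel \<phi> \<nu> K"
    and E: "E \<in> sets borel"
  shows "emeasure (K x) E = emeasure (K y) E"
proof -
  have "\<phi> (x, z) = \<phi> (y, z)" for z
  proof -
    have "continuous_on UNIV \<phi>"
      using \<phi> by (simp add: random_continuous_map_def)
    moreover have "continuous_on UNIV (\<lambda>x :: unit_interval. (x, z))"
      by (intro continuous_intros)
    ultimately have "continuous_on UNIV (\<lambda>x. \<phi> (x, z))"
      by (rule continuous_on_compose2) simp
    then have conn: "connected (range (\<lambda>x. \<phi> (x, z)))"
      using connected_continuous_image connected_unit_interval by blast
    have "open {\<phi> (x, z)}" "open (- {\<phi> (x, z)})"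
      by (rule Topological_Spaces.open_discrete)+
    from connectedD[OF conn this] have "range (\<lambda>x. \<phi> (x, z)) \<inter> - {\<phi> (x, z)} = {}"
      by auto
    moreover have "\<phi> (y, z) \<in> range (\<lambda>x. \<phi> (x, z))" by (rule rangeI)
    ultimately have "\<phi> (y, z) \<in> {\<phi> (x, z)}" by blast
    then show ?thesis by simp
  qed
  then show ?thesis
    using K E by (simp add: implements_kernel_def)
qed

text \<open>
  The indicator function of the point 0 is a projection, and \<open>F\<close> sends it to the coordinate
  function of the interval.
\<close>

lemma not_classically_implemented:
  fixes \<pi> :: "(unit_interval \<Rightarrow>\<^sub>C complex) \<Rightarrow> 'i op" and \<rho> :: "'c::cstar_algebra \<Rightarrow> 'j op"
    and \<phi> :: "(bit \<Rightarrow>\<^sub>C complex) \<Rightarrow> ('i \<times> 'j) op"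
  assumes rqm: "classical_random_quantum_map \<pi> \<rho> \<phi> \<nu>" and impl: "implements_operator \<pi> \<rho> \<phi> \<nu> F"
    and F: "\<And>f x. apply_bcontfun (F f) x = apply_bcontfun f 0 * of_real (real_of_unit x)
      + apply_bcontfun f 1 * of_real (1 - real_of_unit x)"
  shows False
proof -
  obtain S where S: "slice_map \<pi> \<rho> \<nu> S" "\<And>b. F b = S (\<phi> b)"
    using impl by (auto simp: implements_operator_def)
  have \<phi>: "representation \<phi>" "range \<phi> \<subseteq> spatial_tensor \<pi> \<rho>"
    using rqm by (auto simp: classical_random_quantum_map_def random_quantum_map_def)
  let ?e = "\<lambda>y::bit. if y = 0 then 1 else 0 :: complex"
  define e where "e = Bcontfun ?e"
  have "?e \<in> bcontfun"
    by (rule bcontfun_normI[where b = 1]) (auto intro: continuous_on_discrete)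
  then have e: "apply_bcontfun e = ?e"
    unfolding e_def by (rule Bcontfun_inverse)
  have "e * e = e"
    by (rule bcontfun_eqI) (simp add: e)
  show False
  proof (rule slice_of_projection_not_coordinate[of \<pi> \<rho> \<nu> S "\<phi> e"])
    show "faithful_representation \<pi>" "representation \<rho>" "state \<nu>" "c * d = d * c" for c d :: 'c
      using rqm unfolding classical_random_quantum_map_def random_quantum_map_def
        faithful_representation_def by blast+
    show "slice_map \<pi> \<rho> \<nu> S" by (rule S)
    show "\<phi> e \<in> spatial_tensor \<pi> \<rho>" using \<phi>(2) by blast
    show "\<phi> e o\<^sub>L \<phi> e = \<phi> e"
      using rep_mult[OF \<phi>(1), of e e] \<open>e * e = e\<close> by simp
    have "norm e \<le> 1"
      by (rule norm_bound) (simp add: e)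
    then show "norm (\<phi> e) \<le> 1"
      using rep_bcontfun_contractive[OF \<phi>(1), of e] by linarith
    show "apply_bcontfun (S (\<phi> e)) x = of_real (real_of_unit x)" for x
      by (simp add: F e flip: S(2))
  qed
qed

theorem mainTheorem5:
  fixes K :: "unit_interval \<Rightarrow> bit measure"
  assumes "\<And>x. K x \<in> prob_measures"
    and "\<And>x. measure (K x) {0} = real_of_unit x"
    and "\<And>x. measure (K x) {1} = 1 - real_of_unit x"
  shows "kernel K \<and>
    (\<forall>f x. apply_bcontfun (feller_markov K f) x =
       apply_bcontfun f 0 * of_real (real_of_unit x) +
       apply_bcontfun f 1 * of_real (1 - real_of_unit x)) \<and>
    \<not> (\<exists>(\<phi> :: unit_interval \<times> 'z::t2_space \<Rightarrow> bit) \<nu>.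
         random_continuous_map \<phi> \<nu> \<and> implements_kernel \<phi> \<nu> K) \<and>
    \<not> (\<exists>(\<pi> :: (unit_interval \<Rightarrow>\<^sub>C complex) \<Rightarrow> 'i op) (\<rho> :: 'c::cstar_algebra \<Rightarrow> 'j op)
          (\<phi> :: (bit \<Rightarrow>\<^sub>C complex) \<Rightarrow> ('i \<times> 'j) op) \<nu>.
         classical_random_quantum_map \<pi> \<rho> \<phi> \<nu> \<and>
         implements_operator \<pi> \<rho> \<phi> \<nu> (feller_markov K)) \<and>
    (\<exists>(\<pi> :: (unit_interval \<Rightarrow>\<^sub>C complex) \<Rightarrow> unit_interval op) (\<rho> :: 2 cmatrix \<Rightarrow> 2 op)
       (\<phi> :: (bit \<Rightarrow>\<^sub>C complex) \<Rightarrow> (unit_interval \<times> 2) op) \<nu>.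
         random_quantum_map \<pi> \<rho> \<phi> \<nu> \<and>
         implements_operator \<pi> \<rho> \<phi> \<nu> (feller_markov K))"
proof -
  have integral: "(\<integral>y. apply_bcontfun f y \<partial>K x) = apply_bcontfun f 0 * of_real (real_of_unit x)
      + apply_bcontfun f 1 * of_real (1 - real_of_unit x)" for f :: "bit \<Rightarrow>\<^sub>C complex" and x
    using assms by (simp add: integral_bit)
  have cont: "continuous_on UNIV (\<lambda>x. \<integral>y. apply_bcontfun f y \<partial>K x)" for f :: "bit \<Rightarrow>\<^sub>C complex"
    unfolding integral by (intro continuous_intros continuous_on_real_of_unit)
  have "kernel K"
    using assms(1) cont by (auto simp: kernel_def)
  moreover have FM: "apply_bcontfun (feller_markov K f) x =
       apply_bcontfun f 0 * of_real (real_of_unit x) +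
       apply_bcontfun f 1 * of_real (1 - real_of_unit x)" for f x
  proof -
    have "compact (range (\<lambda>x. \<integral>y. apply_bcontfun f y \<partial>K x))"
      by (rule compact_continuous_image[OF cont compact_unit_interval])
    then have "(\<lambda>x. \<integral>y. apply_bcontfun f y \<partial>K x) \<in> bcontfun"
      using cont compact_imp_bounded by (auto simp: bcontfun_def)
    then show ?thesis
      by (simp add: feller_markov_def Bcontfun_inverse integral)
  qed
  moreover have "\<not> (\<exists>(\<phi> :: unit_interval \<times> 'z::t2_space \<Rightarrow> bit) \<nu>.
      random_continuous_map \<phi> \<nu> \<and> implements_kernel \<phi> \<nu> K)"
  proof
    assume "\<exists>(\<phi> :: unit_interval \<times> 'z \<Rightarrow> bit) \<nu>. random_continuous_map \<phi> \<nu> \<and> implements_kernel \<phi> \<nu> K"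
    then obtain \<phi> :: "unit_interval \<times> 'z \<Rightarrow> bit" and \<nu>
      where "random_continuous_map \<phi> \<nu>" "implements_kernel \<phi> \<nu> K" by blast
    from random_continuous_map_implements_constant[OF this sets_borel_bit,
        of "unit_of_real 0" "{0}" "unit_of_real 1"]
    have "measure (K (unit_of_real 0)) {0} = measure (K (unit_of_real 1)) {0}"
      by (simp add: measure_def)
    then show False by (simp add: assms real_of_unit_ends)
  qed
  moreover have "\<not> (\<exists>(\<pi> :: (unit_interval \<Rightarrow>\<^sub>C complex) \<Rightarrow> 'i op) (\<rho> :: 'c::cstar_algebra \<Rightarrow> 'j op)
          (\<phi> :: (bit \<Rightarrow>\<^sub>C complex) \<Rightarrow> ('i \<times> 'j) op) \<nu>.
         classical_random_quantum_map \<pi> \<rho> \<phi> \<nu> \<and>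
         implements_operator \<pi> \<rho> \<phi> \<nu> (feller_markov K))"
    using not_classically_implemented[OF _ _ FM] by blast
  moreover have "random_quantum_map mult_op mat_op (projection_rep path_projection)
      (\<lambda>A :: 2 cmatrix. mat_of A $ 1 $ 1)"
    unfolding random_quantum_map_def
    by (intro conjI faithful_mult_op faithful_mat_op representation_path range_path state_corner)
  moreover have "implements_operator mult_op mat_op (projection_rep path_projection)
      (\<lambda>A :: 2 cmatrix. mat_of A $ 1 $ 1) (feller_markov K)"
    unfolding implements_operator_def
  proof (intro exI conjI allI)
    show "slice_map mult_op mat_op (\<lambda>A :: 2 cmatrix. mat_of A $ 1 $ 1)
        (\<lambda>W :: (unit_interval \<times> 2) op. Bcontfun (corner W))"
      by (rule slice_map_corner)
    show "feller_markov K f = Bcontfun (corner (projection_rep path_projection f))" for f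
    proof (rule bcontfun_eqI)
      fix x
      have "projection_rep path_projection f \<in> spatial_tensor mult_op mat_op"
        using range_path by blast
      then show "apply_bcontfun (feller_markov K f) x
          = apply_bcontfun (Bcontfun (corner (projection_rep path_projection f))) x"
        by (simp add: Bcontfun_corner corner_path FM)
    qed
  qed
  ultimately show ?thesis by blast
qed

end
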